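(* Let $(c,\lambda/\mu)$ be a placed skew shape with $n$ boxes. The change-of-basis for the affine Hecke algebra module $\tilde{\mathbb{H}}_n^{(c,\lambda/\mu)}$ expressing the natural basis $\{n_T\mid T\in\mathrm{SYT}(\lambda/\mu)\}$ in terms of the seminormal basis $\{v_T\mid T\in\mathrm{SYT}(\lambda/\mu)\}$ satisfies $$n_T=\sum_{S\le T}\tilde A_{S,T}\,v_S,\qquad\text{with coefficients}\qquad\tilde A_{S,T}=\sum_{\omega\subseteq\pi}\widetilde{\mathrm{wt}}_\pi(\omega),$$ where the first sum is over standard tableaux $S\in\mathrm{SYT}(\lambda/\mu)$ with $S\le T$ in (strong) Bruhat order; the coefficient $\tilde A_{S,T}$ is defined using any path $\pi$ from the column reading tableau $C$ to $T$ in the weak Bruhat graph $\mathcal{B}_n^{\lambda/\mu}$; and the second sum is over all subpaths $\omega\subseteq\pi$ which terminate at $S$.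
   Context: Tableaux. A skew shape $\lambda/\mu$ (partitions $\mu\subseteq\lambda$) is the set of boxes in the diagram of $\lambda$ not in that of $\mu$; rows are counted downward. A Young tableau of shape $\lambda/\mu$ ($n$ boxes) is a filling by $1,\dots,n$, each used once; it is standard if entries increase left to right in rows and top to bottom in columns. $\mathrm{SYT}(\lambda/\mu)$ is the set of standard tableaux. $\sigma\in\mathbb{S}_n$ acts on tableaux by replacing each entry $k$ by $\sigma(k)$; $s_i=(i,i+1)$. The column reading tableau $C$ is the standard tableau obtained by entering $1,\dots,n$ consecutively down the columns, beginning with the southwest-most connected component and filling columns from left to right. $w_T\in\mathbb{S}_n$ is the unique permutation with $w_T(C)=T$. Bruhat order on $\mathrm{SYT}(\lambda/\mu)$: $S\le T$ iff $w_S\le w_T$ in strong Bruhat order on $\mathbb{S}_n$. The weak Bruhat graph $\mathcal{B}_n^{\lambda/\mu}$ is the undirected graph on $\mathrm{SYT}(\lambda/\mu)$ with an edge labeled $s_i$ between $S$ and $T$ whenever $T=s_i(S)$. Affine Hecke algebra. Fix $q\in\mathbb{C}^\ast$ not a root of unity. The affine Hecke algebra $\tilde{\mathbb{H}}_n$ of type A is the associative unital $\mathbb{C}$-algebra generated by $T_i$ ($1\le i\le n-1$) and $X^{\varepsilon_i}$ ($1\le i\le n$) with relations $T_iT_j=T_jT_i$ ($|i-j|>1$); $T_iT_{i+1}T_i=T_{i+1}T_iT_{i+1}$ ($1\le i\le n-2$); $T_i^2=(q-q^{-1})T_i+1$ ($1\le i\le n-1$); $T_iX^{\varepsilon_j}=X^{\varepsilon_j}T_i$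 ($j\ne i,i+1$); $X^{\varepsilon_1}T_1X^{\varepsilon_1}T_1=T_1X^{\varepsilon_1}T_1X^{\varepsilon_1}$; $X^{\varepsilon_{i+1}}=T_iX^{\varepsilon_i}T_i$ ($1\le i\le n-1$). For $w\in\mathbb{S}_n$ with reduced word $w=s_{i_1}\cdots s_{i_k}$, $T_w=T_{i_1}\cdots T_{i_k}$ (independent of the reduced word). Placed skew shapes. A placed skew shape is created by decomposing a skew shape $\lambda/\mu$ into a disjoint union of skew shapes $\lambda/\mu=\bigsqcup_\beta\lambda^{(\beta)}/\mu^{(\beta)}$, indexed by $\beta\in[0,1)+i[0,2\pi/\ln(q^2))$; $\beta$ is called the page number of $\lambda^{(\beta)}/\mu^{(\beta)}$. Each of these skew shapes may be placed arbitrarily, so that its top left box need not lie in position $(1,1)$. The corresponding content function $c:\{\text{boxes of }\lambda/\mu\}\to\mathbb{R}+i[0,2\pi/\ln(q^2))$ is $c(b)=\beta+y-x$ if $b$ is in row $x$ and column $y$ of $\lambda^{(\beta)}/\mu^{(\beta)}$. The pair $(c,\lambda/\mu)$ determines the placed skew shape. Here $q^{2z}=\exp(z\ln(q^2))$. Module. For $T\in\mathrm{SYT}(\lambda/\mu)$ let $T(i)$ be the box of $T$ containing $i$ and $$\tilde a_i(T)=\frac{q-q^{-1}}{1-q^{2(c(T(i))-c(T(i+1)))}}.$$ The irreducible, calibrated module $\tilde{\mathbb{H}}_n^{(c,\lambda/\mu)}$ has $\mathbb{C}$-basis $\{v_T\mid T\in\mathrm{SYT}(\lambda/\mu)\}$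 (the seminormal basis) with action $$X^{\varepsilon_i}v_T=q^{2c(T(i))}v_T,\qquad T_iv_T=\tilde a_i(T)v_T+(q^{-1}+\tilde a_i(T))v_{s_i(T)},$$ where $v_{s_i(T)}=0$ if $s_i(T)$ is nonstandard. The natural basis is $\{n_T\mid T\in\mathrm{SYT}(\lambda/\mu)\}$ with $n_T:=T_{w_T}v_C$. Paths. A path in $\mathcal{B}_n^{\lambda/\mu}$ from $T_0$ to $T_k$ is a sequence $\pi=(T_0\xrightarrow{s_{i_1}}T_1\xrightarrow{s_{i_2}}\cdots\xrightarrow{s_{i_k}}T_k)$ ($k\ge 0$) of standard tableaux with $T_j=s_{i_j}(T_{j-1})$. A subpath $\omega\subseteq\pi$ is a sequence $\omega=(T_0=S_0\xrightarrow{z_1}S_1\xrightarrow{z_2}\cdots\xrightarrow{z_k}S_k)$ of standard tableaux with $z_j\in\{s_{i_j},e\}$ ($e$ the identity) and $S_j=z_j(S_{j-1})$; it terminates at $S_k$. Its $q$-weight is $\widetilde{\mathrm{wt}}_\pi(\omega)=\prod_{j=1}^k\tilde b_j$, where $\tilde b_j=\tilde a_{i_j}(S_{j-1})$ if $z_j=e$ (so $S_j=S_{j-1}$) and $\tilde b_j=\tilde a_{i_j}(S_{j-1})+q^{-1}$ if $z_j=s_{i_j}$ (so $S_j=s_{i_j}(S_{j-1})$); the empty path has weight $1$.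
   Formalization: "Any path π from C to T" is restricted to paths of minimal length ℓ(w_T) (labels spelling a reduced word); for longer paths the formula fails, e.g. two disconnected boxes with π = (C → s_1C → C), as T_1² = (q−q⁻¹)T_1+1. Existence of a minimal path is proved. *)

theory Defs
  imports
    "HOL-Analysis.Analysis"
    "HOL-Combinatorics.Permutations"
    "HOL-Algebra.QuotRing"
    "HOL-Library.Poly_Mapping"
begin

section \<open>Skew shapes and tableaux\<close>

text \<open>A box is a pair (row, column); rows are counted downward.  Integer coordinates are used so
  that diagrams can be translated freely.\<close>

type_synonym box = "int \<times> int"

definition is_partition :: "nat list \<Rightarrow> bool" where
  "is_partition l \<longleftrightarrow> sorted_wrt (\<ge>) l \<and> 0 \<notin> set l"

definition diagram :: "nat list \<Rightarrow> box set" where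
  "diagram l = {(x, y). 1 \<le> x \<and> x \<le> int (length l) \<and> 1 \<le> y \<and> y \<le> int (l ! nat (x - 1))}"

definition skew_shape :: "nat list \<Rightarrow> nat list \<Rightarrow> bool" where
  "skew_shape lam mu \<longleftrightarrow> is_partition lam \<and> is_partition mu \<and> diagram mu \<subseteq> diagram lam"

definition boxes :: "nat list \<Rightarrow> nat list \<Rightarrow> box set" where
  "boxes lam mu = diagram lam - diagram mu"

text \<open>A filling is extended by 0 outside the diagram, so that tableaux are determined by their
  entries and permutations of \<open>{1..n}\<close> (which fix 0) act by composition.\<close>

type_synonym tableau = "box \<Rightarrow> nat"

definition young_tableau :: "box set \<Rightarrow> tableau \<Rightarrow> bool" where
  "young_tableau D T \<longleftrightarrow> bij_betw T D {1..card D} \<and> (\<forall>b. b \<notin> D \<longrightarrow> T b = 0)"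

definition SYT :: "box set \<Rightarrow> tableau set" where
  "SYT D = {T. young_tableau D T
     \<and> (\<forall>x y y'. (x, y) \<in> D \<longrightarrow> (x, y') \<in> D \<longrightarrow> y < y' \<longrightarrow> T (x, y) < T (x, y'))
     \<and> (\<forall>x x' y. (x, y) \<in> D \<longrightarrow> (x', y) \<in> D \<longrightarrow> x < x' \<longrightarrow> T (x, y) < T (x', y))}"

definition tab_act :: "(nat \<Rightarrow> nat) \<Rightarrow> tableau \<Rightarrow> tableau" where
  "tab_act \<sigma> T = \<sigma> \<circ> T"

definition box_of :: "box set \<Rightarrow> tableau \<Rightarrow> nat \<Rightarrow> box" where
  "box_of D T i = (THE b. b \<in> D \<and> T b = i)"

text \<open>The connected components of a skew shape, listed from southwest to northeast, occupy disjoint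
  blocks of columns that move strictly to the right.  Filling the components one after another, each
  by columns from left to right, therefore fills all columns of the shape from left to right, each
  from top to bottom.\<close>

definition column_tableau :: "box set \<Rightarrow> tableau" where
  "column_tableau D = (\<lambda>(x, y). if (x, y) \<in> D
     then card {(x', y'). (x', y') \<in> D \<and> (y' < y \<or> y' = y \<and> x' \<le> x)} else 0)"

definition tab_perm :: "box set \<Rightarrow> tableau \<Rightarrow> nat \<Rightarrow> nat" where
  "tab_perm D T = (THE w. w permutes {1..card D} \<and> tab_act w (column_tableau D) = T)"

section \<open>The symmetric group\<close>

definition simple_refl :: "nat \<Rightarrow> nat \<Rightarrow> nat" where
  "simple_refl i = Transposition.transpose i (i + 1)"

definition word_perm :: "nat list \<Rightarrow> nat \<Rightarrow> nat" where
  "word_perm is = foldr (\<lambda>i w. simple_refl i \<circ> w) is id"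

definition cox_length :: "nat \<Rightarrow> (nat \<Rightarrow> nat) \<Rightarrow> nat" where
  "cox_length n w = (LEAST k. \<exists>is. set is \<subseteq> {1..<n} \<and> word_perm is = w \<and> length is = k)"

definition reduced_word :: "nat \<Rightarrow> (nat \<Rightarrow> nat) \<Rightarrow> nat list \<Rightarrow> bool" where
  "reduced_word n w is \<longleftrightarrow>
     set is \<subseteq> {1..<n} \<and> word_perm is = w \<and> length is = cox_length n w"

text \<open>Strong Bruhat order: the reflexive transitive closure of \<open>u < u t\<close> for \<open>t\<close> a
  transposition that increases the length.\<close>

inductive bruhat_le :: "nat \<Rightarrow> (nat \<Rightarrow> nat) \<Rightarrow> (nat \<Rightarrow> nat) \<Rightarrow> bool" for n where
  bruhat_refl: "w permutes {1..n} \<Longrightarrow> bruhat_le n w w"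
| bruhat_step: "bruhat_le n u w \<Longrightarrow> a \<in> {1..n} \<Longrightarrow> b \<in> {1..n} \<Longrightarrow> a \<noteq> b \<Longrightarrow>
    cox_length n w < cox_length n (w \<circ> Transposition.transpose a b) \<Longrightarrow> bruhat_le n u (w \<circ> Transposition.transpose a b)"

definition tab_le :: "box set \<Rightarrow> tableau \<Rightarrow> tableau \<Rightarrow> bool" where
  "tab_le D S T \<longleftrightarrow> bruhat_le (card D) (tab_perm D S) (tab_perm D T)"

section \<open>Placed skew shapes\<close>

definition q_pow2 :: "complex \<Rightarrow> complex \<Rightarrow> complex" where
  "q_pow2 q z = exp (z * ln (q\<^sup>2))"

text \<open>The set \<open>[0,1) + i[0, 2\<pi>/ln(q^2))\<close>.  For complex \<open>ln(q^2)\<close> the half-open interval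
  \<open>[0, p)\<close> is read as the segment from 0 (included) to \<open>p\<close> (excluded).\<close>

definition page_numbers :: "complex \<Rightarrow> complex set" where
  "page_numbers q = {complex_of_real s + \<i> * (complex_of_real t * (2 * complex_of_real pi / ln (q\<^sup>2)))
     | s t. 0 \<le> s \<and> s < 1 \<and> 0 \<le> t \<and> t < 1}"

definition placed_diagram :: "box set \<Rightarrow> bool" where
  "placed_diagram P \<longleftrightarrow> (\<exists>lam mu dx dy. skew_shape lam mu \<and>
     P = (\<lambda>(x, y). (x + dx, y + dy)) ` boxes lam mu)"

text \<open>\<open>page b\<close> is the page number of the box \<open>b\<close> of the skew shape and \<open>place b\<close> its (row, column)
  in the placed skew shape on that page.  That the shape is the disjoint union of the pages is
  expressed by the two neighbour conditions: boxes are adjacent in the shape exactly if they lie on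
  the same page and are adjacent there.\<close>

definition placed_skew_shape ::
    "complex \<Rightarrow> nat list \<Rightarrow> nat list \<Rightarrow> (box \<Rightarrow> complex) \<Rightarrow> bool" where
  "placed_skew_shape q lam mu c \<longleftrightarrow> skew_shape lam mu \<and>
     (\<exists>(page :: box \<Rightarrow> complex) (place :: box \<Rightarrow> box).
        (\<forall>b \<in> boxes lam mu. page b \<in> page_numbers q) \<and>
        (\<forall>\<beta>. inj_on place {b \<in> boxes lam mu. page b = \<beta>} \<and>
             placed_diagram (place ` {b \<in> boxes lam mu. page b = \<beta>})) \<and>
        (\<forall>b \<in> boxes lam mu. \<forall>b' \<in> boxes lam mu.
           (b' = (fst b, snd b + 1)
              \<longleftrightarrow> page b' = page b \<and> place b' = (fst (place b), snd (place b) + 1)) \<and>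
           (b' = (fst b + 1, snd b)
              \<longleftrightarrow> page b' = page b \<and> place b' = (fst (place b) + 1, snd (place b)))) \<and>
        (\<forall>b \<in> boxes lam mu. c b = page b + of_int (snd (place b)) - of_int (fst (place b))))"

section \<open>The affine Hecke algebra\<close>

datatype hecke_gen = GenT nat | GenX nat

text \<open>Words form a free monoid, written additively because this is what the convolution product on
  finitely supported functions requires.  Finitely supported functions on words are then the free
  algebra.\<close>

datatype hecke_word = Word (letters: "hecke_gen list")

instantiation hecke_word :: monoid_add
begin
definition "0 = Word []"
definition "u + v = Word (letters u @ letters v)"
instance
  by standard (simp_all add: zero_hecke_word_def plus_hecke_word_def)
end

type_synonym hecke_poly = "hecke_word \<Rightarrow>\<^sub>0 complex"

definition hecke_gens :: "nat \<Rightarrow> hecke_gen set" where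
  "hecke_gens n = GenT ` {1..<n} \<union> GenX ` {1..n}"

definition free_hecke :: "nat \<Rightarrow> hecke_poly ring" where
  "free_hecke n = \<lparr>carrier = {f. \<forall>w \<in> Poly_Mapping.keys f. set (letters w) \<subseteq> hecke_gens n},
     mult = (*), one = 1, zero = 0, add = (+)\<rparr>"

definition fscal :: "complex \<Rightarrow> hecke_poly" where
  "fscal a = Poly_Mapping.single 0 a"

definition fT :: "nat \<Rightarrow> hecke_poly" where
  "fT i = Poly_Mapping.single (Word [GenT i]) 1"

definition fX :: "nat \<Rightarrow> hecke_poly" where
  "fX i = Poly_Mapping.single (Word [GenX i]) 1"

definition hecke_relators :: "nat \<Rightarrow> complex \<Rightarrow> hecke_poly set" where
  "hecke_relators n q =
     {fT i * fT j - fT j * fT i | i j. i \<in> {1..<n} \<and> j \<in> {1..<n} \<and> \<bar>int i - int j\<bar> > 1}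
   \<union> {fT i * fT (i + 1) * fT i - fT (i + 1) * fT i * fT (i + 1) | i. 1 \<le> i \<and> i + 1 < n}
   \<union> {fT i * fT i - (fscal (q - inverse q) * fT i + 1) | i. i \<in> {1..<n}}
   \<union> {fT i * fX j - fX j * fT i | i j. i \<in> {1..<n} \<and> j \<in> {1..n} \<and> j \<noteq> i \<and> j \<noteq> i + 1}
   \<union> (if 2 \<le> n then {fX 1 * fT 1 * fX 1 * fT 1 - fT 1 * fX 1 * fT 1 * fX 1} else {})
   \<union> {fX (i + 1) - fT i * fX i * fT i | i. i \<in> {1..<n}}"

definition hecke_ideal :: "nat \<Rightarrow> complex \<Rightarrow> hecke_poly set" where
  "hecke_ideal n q = genideal (free_hecke n) (hecke_relators n q)"

definition affine_hecke :: "nat \<Rightarrow> complex \<Rightarrow> hecke_poly set ring" where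
  "affine_hecke n q = free_hecke n Quot hecke_ideal n q"

definition hecke_class :: "nat \<Rightarrow> complex \<Rightarrow> hecke_poly \<Rightarrow> hecke_poly set" where
  "hecke_class n q f = hecke_ideal n q +>\<^bsub>free_hecke n\<^esub> f"

definition hecke_T :: "nat \<Rightarrow> complex \<Rightarrow> nat \<Rightarrow> hecke_poly set" where
  "hecke_T n q i = hecke_class n q (fT i)"

definition hecke_X :: "nat \<Rightarrow> complex \<Rightarrow> nat \<Rightarrow> hecke_poly set" where
  "hecke_X n q i = hecke_class n q (fX i)"

definition hecke_scal :: "nat \<Rightarrow> complex \<Rightarrow> complex \<Rightarrow> hecke_poly set" where
  "hecke_scal n q a = hecke_class n q (fscal a)"

definition hecke_Tw :: "nat \<Rightarrow> complex \<Rightarrow> (nat \<Rightarrow> nat) \<Rightarrow> hecke_poly set" where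
  "hecke_Tw n q w = foldr (\<lambda>i h. hecke_T n q i \<otimes>\<^bsub>affine_hecke n q\<^esub> h)
     (SOME is. reduced_word n w is) \<one>\<^bsub>affine_hecke n q\<^esub>"

lemma free_hecke_ring: "ring (free_hecke n)"
proof -
  let ?F = "free_hecke n"
  have mult_closed: "f * g \<in> carrier ?F" if "f \<in> carrier ?F" "g \<in> carrier ?F" for f g
  proof -
    have "set (letters w) \<subseteq> hecke_gens n" if w: "w \<in> Poly_Mapping.keys (f * g)" for w
    proof -
      from w keys_mult[of f g] obtain u u'
        where "w = u + u'" "u \<in> Poly_Mapping.keys f" "u' \<in> Poly_Mapping.keys g" by blast
      then show ?thesis
        using \<open>f \<in> carrier ?F\<close> \<open>g \<in> carrier ?F\<close>
        by (simp add: free_hecke_def plus_hecke_word_def)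
    qed
    then show ?thesis by (simp add: free_hecke_def)
  qed
  have add_closed: "f + g \<in> carrier ?F" if "f \<in> carrier ?F" "g \<in> carrier ?F" for f g
    using that Poly_Mapping.keys_add[of f g] unfolding free_hecke_def by fastforce
  have uminus_closed: "- f \<in> carrier ?F" if "f \<in> carrier ?F" for f
    using that by (simp add: free_hecke_def)
  have zero_closed: "0 \<in> carrier ?F" and one_closed: "1 \<in> carrier ?F"
    by (simp_all add: free_hecke_def zero_hecke_word_def)
  have sel: "mult ?F = (*)" "add ?F = (+)" "zero ?F = 0" "one ?F = 1"
    by (simp_all add: free_hecke_def)
  show ?thesis
  proof (rule ringI)
    show "abelian_group ?F"
      by (rule abelian_groupI)
        (simp_all add: sel add_closed zero_closed add.assoc add.commute,
          metis uminus_closed add.right_inverse)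
    show "Group.monoid ?F"
      by (rule Group.monoidI) (simp_all add: sel mult_closed one_closed mult.assoc)
  qed (simp_all add: sel distrib_left distrib_right)
qed

lemma affine_hecke_ring: "ring (affine_hecke n q)"
proof -
  interpret ring "free_hecke n" by (rule free_hecke_ring)
  have sub: "f - g \<in> carrier (free_hecke n)" if "f \<in> carrier (free_hecke n)" "g \<in> carrier (free_hecke n)"
    for f g
    using that Poly_Mapping.keys_diff[of f g] unfolding free_hecke_def by fastforce
  have clo: "f * g \<in> carrier (free_hecke n)" "f + g \<in> carrier (free_hecke n)"
    if "f \<in> carrier (free_hecke n)" "g \<in> carrier (free_hecke n)" for f g
    using m_closed[OF that] a_closed[OF that] by (simp_all add: free_hecke_def)
  have gens: "1 \<in> carrier (free_hecke n)" "fscal a \<in> carrier (free_hecke n)"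
    "i \<in> {1..<n} \<Longrightarrow> fT i \<in> carrier (free_hecke n)"
    "i \<in> {1..n} \<Longrightarrow> fX i \<in> carrier (free_hecke n)" for i a
    by (auto simp: free_hecke_def fT_def fX_def fscal_def hecke_gens_def zero_hecke_word_def)
  have "hecke_relators n q \<subseteq> carrier (free_hecke n)"
    unfolding hecke_relators_def
    by (intro Un_least) (auto split: if_splits intro!: sub clo gens)
  then have "ideal (hecke_ideal n q) (free_hecke n)"
    unfolding hecke_ideal_def by (rule genideal_ideal)
  then show ?thesis
    unfolding affine_hecke_def by (rule ideal.quotient_is_ring)
qed

section \<open>The calibrated module\<close>

locale hecke_module = vector_space scale
  for scale :: "complex \<Rightarrow> 'v :: ab_group_add \<Rightarrow> 'v" +
  fixes n :: nat and q :: complex and act :: "hecke_poly set \<Rightarrow> 'v \<Rightarrow> 'v"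
  assumes act_add_right: "h \<in> carrier (affine_hecke n q) \<Longrightarrow> act h (x + y) = act h x + act h y"
    and act_add_left: "g \<in> carrier (affine_hecke n q) \<Longrightarrow> h \<in> carrier (affine_hecke n q) \<Longrightarrow>
      act (g \<oplus>\<^bsub>affine_hecke n q\<^esub> h) x = act g x + act h x"
    and act_mult: "g \<in> carrier (affine_hecke n q) \<Longrightarrow> h \<in> carrier (affine_hecke n q) \<Longrightarrow>
      act (g \<otimes>\<^bsub>affine_hecke n q\<^esub> h) x = act g (act h x)"
    and act_one: "act \<one>\<^bsub>affine_hecke n q\<^esub> x = x"
    and act_scal: "act (hecke_scal n q a) x = scale a x"

definition a_coeff :: "complex \<Rightarrow> box set \<Rightarrow> (box \<Rightarrow> complex) \<Rightarrow> nat \<Rightarrow> tableau \<Rightarrow> complex" where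
  "a_coeff q D c i T =
     (q - inverse q) / (1 - q_pow2 q (c (box_of D T i) - c (box_of D T (i + 1))))"

locale calibrated_module = hecke_module scale "card (boxes lam mu)" q act
  for scale :: "complex \<Rightarrow> 'v :: ab_group_add \<Rightarrow> 'v"
    and q :: complex and act :: "hecke_poly set \<Rightarrow> 'v \<Rightarrow> 'v"
    and lam mu :: "nat list" +
  fixes c :: "box \<Rightarrow> complex" and v :: "tableau \<Rightarrow> 'v"
  assumes basis_inj: "inj_on v (SYT (boxes lam mu))"
    and basis_independent: "independent (v ` SYT (boxes lam mu))"
    and basis_span: "span (v ` SYT (boxes lam mu)) = UNIV"
    and act_X: "T \<in> SYT (boxes lam mu) \<Longrightarrow> i \<in> {1..card (boxes lam mu)} \<Longrightarrow>
      act (hecke_X (card (boxes lam mu)) q i) (v T)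
        = scale (q_pow2 q (c (box_of (boxes lam mu) T i))) (v T)"
    and act_T: "T \<in> SYT (boxes lam mu) \<Longrightarrow> i \<in> {1..<card (boxes lam mu)} \<Longrightarrow>
      act (hecke_T (card (boxes lam mu)) q i) (v T)
        = scale (a_coeff q (boxes lam mu) c i T) (v T)
          + scale (inverse q + a_coeff q (boxes lam mu) c i T)
              (if tab_act (simple_refl i) T \<in> SYT (boxes lam mu)
               then v (tab_act (simple_refl i) T) else 0)"

definition natural_vec ::
    "complex \<Rightarrow> box set \<Rightarrow> (hecke_poly set \<Rightarrow> 'v \<Rightarrow> 'v) \<Rightarrow> (tableau \<Rightarrow> 'v) \<Rightarrow> tableau \<Rightarrow> 'v" where
  "natural_vec q D act v T = act (hecke_Tw (card D) q (tab_perm D T)) (v (column_tableau D))"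

section \<open>Paths and subpaths\<close>

text \<open>A path \<open>T_0 \<rightarrow> ... \<rightarrow> T_k\<close> is given by the list \<open>is\<close> of the \<open>k\<close> indices of its labels and
  the list \<open>Ts\<close> of its \<open>k + 1\<close> tableaux.  Paths may revisit tableaux.  Since \<open>T_i^2 = 1\<close> fails in the
  affine Hecke algebra, only paths from the column reading tableau to \<open>T\<close> whose number of steps is the
  length of \<open>w_T\<close>, i.e. whose labels spell a reduced word, compute \<open>T_{w_T}\<close>.\<close>

definition is_path :: "box set \<Rightarrow> tableau \<Rightarrow> tableau \<Rightarrow> nat list \<Rightarrow> tableau list \<Rightarrow> bool" where
  "is_path D S T is Ts \<longleftrightarrow>
     set is \<subseteq> {1..<card D} \<and> set Ts \<subseteq> SYT D \<and> length Ts = length is + 1 \<and>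
     hd Ts = S \<and> last Ts = T \<and>
     (\<forall>j < length is. Ts ! (j + 1) = tab_act (simple_refl (is ! j)) (Ts ! j))"

text \<open>A subpath is given by the list \<open>zs\<close> of its permutations \<open>z_j\<close> (each \<open>s_{i_j}\<close> or the
  identity) and the list \<open>Ss\<close> of its tableaux.\<close>

definition subpaths ::
    "box set \<Rightarrow> nat list \<Rightarrow> tableau list \<Rightarrow> ((nat \<Rightarrow> nat) list \<times> tableau list) set" where
  "subpaths D is Ts = {(zs, Ss).
     length zs = length is \<and> length Ss = length is + 1 \<and> set Ss \<subseteq> SYT D \<and> hd Ss = hd Ts \<and>
     (\<forall>j < length is. zs ! j \<in> {simple_refl (is ! j), id} \<and> Ss ! (j + 1) = tab_act (zs ! j) (Ss ! j))}"

definition q_weight ::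
    "complex \<Rightarrow> box set \<Rightarrow> (box \<Rightarrow> complex) \<Rightarrow> nat list \<Rightarrow> (nat \<Rightarrow> nat) list \<times> tableau list \<Rightarrow> complex"
  where
  "q_weight q D c is \<omega> = (\<Prod>j < length is.
     if fst \<omega> ! j = id then a_coeff q D c (is ! j) (snd \<omega> ! j)
     else a_coeff q D c (is ! j) (snd \<omega> ! j) + inverse q)"

definition path_coeff ::
    "complex \<Rightarrow> box set \<Rightarrow> (box \<Rightarrow> complex) \<Rightarrow> nat list \<Rightarrow> tableau list \<Rightarrow> tableau \<Rightarrow> complex" where
  "path_coeff q D c is Ts S =
     (\<Sum>\<omega> \<in> {\<omega> \<in> subpaths D is Ts. last (snd \<omega>) = S}. q_weight q D c is \<omega>)"

end

theory Submission
  imports Defs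
begin

text \<open>
  Let \<open>C\<close> be the column reading tableau and \<open>u = [i_1, ..., i_k]\<close> the labels of a path from \<open>C\<close> to
  \<open>T\<close> whose number of steps is the length of \<open>w_T\<close>.  Each step multiplies the permutation on the
  left by a simple reflection, so \<open>w_T = s_{i_k} ... s_{i_1}\<close> and the reversed label word is a reduced
  word of \<open>w_T\<close> (\<open>path_reduced_word\<close>).  As the operators \<open>T_i\<close> satisfy the braid relations, a product
  along a reduced word depends only on the permutation (\<open>foldr_reduced_word_unique\<close>), and
  therefore \<open>n_T = T_{i_k} ... T_{i_1} v_C\<close> for this particular path (\<open>act_hecke_Tw\<close>).

  Now apply \<open>T_{i_1}\<close>, \<open>T_{i_2}\<close>, ... in turn.  By the seminormal action each operator turns \<open>v_S\<close> into
  a multiple of \<open>v_S\<close> (the subpath stays) plus a multiple of \<open>v_{s_i S}\<close> (the subpath follows the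
  path), where the second term is absent when \<open>s_i S\<close> is nonstandard.  Expanding the product thus
  enumerates the subpaths with their weights (\<open>fold_T_op_subpaths\<close>); grouping them by their
  endpoints gives the coefficients.

  Only tableaux \<open>S \<le> T\<close> occur as endpoints (\<open>subpath_bruhat_le\<close>).  A subpath need not spell a
  reduced word, so the argument runs along the path step by step: the inequality \<open>w_S \<le> w_T\<close> survives
  a step that lengthens the larger permutation, whether or not the smaller one is multiplied too.
  This is the lifting property of Bruhat order (\<open>bruhat_le_lift\<close>).

  A path of the required length exists because \<open>T\<close> can be sorted down to \<open>C\<close>.  If \<open>i\<close> is a left descent
  of \<open>w_T\<close>, the box of \<open>i + 1\<close> precedes the box of \<open>i\<close> in the column reading order; the two boxes then
  share neither a row nor a column, and \<open>s_i T\<close> is standard again (\<open>SYT_descend\<close>).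

  All statements about lengths rest on the identification of the Coxeter length with the number of
  inversions (\<open>cox_length_eq_card_inversions\<close>).
\<close>

section \<open>Length in the symmetric group\<close>

text \<open>The prefix \<open>inv\<close> is the inverse in an implicit algebraic structure here, so the inverse
  function gets a name of its own.\<close>

abbreviation perm_inv :: "('a \<Rightarrow> 'b) \<Rightarrow> 'b \<Rightarrow> 'a" where
  "perm_inv \<equiv> inv_into UNIV"

definition inversions :: "nat \<Rightarrow> (nat \<Rightarrow> nat) \<Rightarrow> (nat \<times> nat) set" where
  "inversions n w = {(a, b). 1 \<le> a \<and> a < b \<and> b \<le> n \<and> w b < w a}"

lemma finite_inversions: "finite (inversions n w)"
  by (rule finite_subset[of _ "{..n} \<times> {..n}"]) (auto simp: inversions_def)

lemma simple_refl_permutes: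
  assumes "i \<in> {1..<n}"
  shows "simple_refl i permutes {1..n}"
  unfolding simple_refl_def using assms by (intro permutes_swap_id) auto

lemma simple_refl_involutive [simp]: "simple_refl i (simple_refl i k) = k"
  by (simp add: simple_refl_def)

lemma simple_refl_comp_cancel [simp]: "simple_refl i \<circ> (simple_refl i \<circ> w) = w"
  by (simp add: fun_eq_iff)

lemma simple_refl_neq_id [simp]: "simple_refl i \<noteq> id"
proof
  assume "simple_refl i = id"
  then have "simple_refl i i = id i" by simp
  then show False by (simp add: simple_refl_def)
qed

text \<open>A simple reflection exchanges two neighbours, so it can reverse no other comparison.  This is
  the source of every length computation below.\<close>

lemma simple_refl_less_iff:
  assumes "{x, y} \<noteq> {i, i + 1}"
  shows "simple_refl i x < simple_refl i y \<longleftrightarrow> x < y"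
  using assms by (auto simp: simple_refl_def Transposition.transpose_def doubleton_eq_iff)

lemma comp_permutes_simple:
  assumes "w permutes {1..n}" "i \<in> {1..<n}"
  shows "(simple_refl i \<circ> w) permutes {1..n}"
  by (rule permutes_compose[OF assms(1) simple_refl_permutes[OF assms(2)]])

lemma inv_simple_comp:
  assumes "w permutes {1..n}"
  shows "perm_inv (simple_refl i \<circ> w) k = perm_inv w (simple_refl i k)"
proof -
  have "bij w" using assms by (rule permutes_bij)
  moreover have "bij (simple_refl i)" by (simp add: simple_refl_def)
  moreover have "perm_inv (simple_refl i) = simple_refl i"
    by (simp add: simple_refl_def)
  ultimately show ?thesis by (simp add: o_inv_distrib)
qed

text \<open>Multiplying by \<open>s_i\<close> on the left changes values, not positions; only the positions that carry
  the values \<open>i\<close> and \<open>i + 1\<close> see their comparison reversed.  Hence the inversion sets themselves are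
  nested, and their sizes differ by exactly one.\<close>

lemma inversions_simple_up:
  assumes w: "w permutes {1..n}" and i: "i \<in> {1..<n}" and up: "perm_inv w i < perm_inv w (i + 1)"
  shows "inversions n (simple_refl i \<circ> w) = insert (perm_inv w i, perm_inv w (i + 1)) (inversions n w)"
proof -
  have winv: "w (perm_inv w k) = k" "perm_inv w (w k) = k" for k
    using permutes_inverses[OF w] by auto
  have rng: "perm_inv w i \<in> {1..n}" "perm_inv w (i + 1) \<in> {1..n}"
    using permutes_in_image[OF permutes_inv[OF w]] i by auto
  have "(a, b) \<in> inversions n (simple_refl i \<circ> w) \<longleftrightarrow>
        (a, b) \<in> insert (perm_inv w i, perm_inv w (i + 1)) (inversions n w)" for a b
  proof (cases "{w a, w b} = {i, i + 1}")
    case True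
    then have "w a = i \<and> w b = i + 1 \<or> w a = i + 1 \<and> w b = i"
      by (simp add: doubleton_eq_iff)
    then show ?thesis
    proof
      assume ab: "w a = i \<and> w b = i + 1"
      then have "perm_inv w i = a" "perm_inv w (i + 1) = b" using winv(2) by metis+
      with ab rng up show ?thesis by (simp add: inversions_def simple_refl_def)
    next
      assume ab: "w a = i + 1 \<and> w b = i"
      then have "perm_inv w i = b" "perm_inv w (i + 1) = a" using winv(2) by metis+
      with ab rng up show ?thesis by (simp add: inversions_def simple_refl_def)
    qed
  next
    case False
    then have "(a, b) \<noteq> (perm_inv w i, perm_inv w (i + 1))" using winv by auto
    moreover have "simple_refl i (w b) < simple_refl i (w a) \<longleftrightarrow> w b < w a"
      using False by (intro simple_refl_less_iff) (simp add: insert_commute)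
    ultimately show ?thesis by (auto simp: inversions_def)
  qed
  then show ?thesis by auto
qed

lemma card_inversions_simple_up:
  assumes w: "w permutes {1..n}" and i: "i \<in> {1..<n}" and up: "perm_inv w i < perm_inv w (i + 1)"
  shows "card (inversions n (simple_refl i \<circ> w)) = card (inversions n w) + 1"
proof -
  have "(perm_inv w i, perm_inv w (i + 1)) \<notin> inversions n w"
    using permutes_inverses[OF w] by (auto simp: inversions_def)
  then show ?thesis
    by (simp add: inversions_simple_up[OF assms] finite_inversions)
qed

lemma card_inversions_simple_down:
  assumes w: "w permutes {1..n}" and i: "i \<in> {1..<n}" and down: "perm_inv w (i + 1) < perm_inv w i"
  shows "card (inversions n w) = card (inversions n (simple_refl i \<circ> w)) + 1"
proof -
  have "perm_inv (simple_refl i \<circ> w) i < perm_inv (simple_refl i \<circ> w) (i + 1)"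
    using down by (simp add: inv_simple_comp[OF w]) (simp add: simple_refl_def)
  from card_inversions_simple_up[OF comp_permutes_simple[OF w i] i this] show ?thesis by simp
qed

lemma inv_neq_succ:
  fixes n :: nat
  assumes "w permutes {1..n}"
  shows "perm_inv w i \<noteq> perm_inv w (i + 1)"
  using permutes_inj[OF permutes_inv[OF assms]] by (simp add: inj_eq)

lemma card_inversions_simple_le:
  assumes w: "w permutes {1..n}" and i: "i \<in> {1..<n}"
  shows "card (inversions n (simple_refl i \<circ> w)) \<le> card (inversions n w) + 1"
proof (cases "perm_inv w i < perm_inv w (i + 1)")
  case True
  then show ?thesis by (simp add: card_inversions_simple_up[OF w i])
next
  case False
  with inv_neq_succ[OF w, of i] have "perm_inv w (i + 1) < perm_inv w i" by linarith
  then show ?thesis by (simp add: card_inversions_simple_down[OF w i])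
qed

lemma left_descent_if_card_inversions_less:
  assumes "w permutes {1..n}" "i \<in> {1..<n}"
    and "card (inversions n (simple_refl i \<circ> w)) < card (inversions n w)"
  shows "perm_inv w (i + 1) < perm_inv w i"
proof (rule ccontr)
  assume "\<not> ?thesis"
  with inv_neq_succ[OF assms(1), of i] have "perm_inv w i < perm_inv w (i + 1)" by linarith
  from card_inversions_simple_up[OF assms(1,2) this] assms(3) show False by simp
qed

text \<open>Without a left descent the inverse is increasing on \<open>{1..n}\<close>, hence dominates the identity
  pointwise, and a permutation with this property is the identity.\<close>

lemma exists_left_descent:
  fixes n :: nat
  assumes w: "w permutes {1..n}" and "w \<noteq> id"
  shows "\<exists>i \<in> {1..<n}. perm_inv w (i + 1) < perm_inv w i"
proof (rule ccontr)
  assume "\<not> ?thesis"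
  then have step: "perm_inv w i < perm_inv w (i + 1)" if "i \<in> {1..<n}" for i
    using that inv_neq_succ[OF w, of i] by (metis linorder_neqE_nat)
  have p: "perm_inv w permutes {1..n}" by (rule permutes_inv[OF w])
  have "k \<in> {1..n} \<Longrightarrow> k \<le> perm_inv w k" for k
  proof (induction k)
    case (Suc k)
    show ?case
    proof (cases "k = 0")
      case True
      then show ?thesis using permutes_in_image[OF p, of "Suc k"] Suc.prems by auto
    next
      case False
      then show ?thesis using Suc step[of k] by auto
    qed
  qed simp
  then have "perm_inv w = id" by (intro permutes_natset_ge[OF p]) auto
  then have "w = id" using permutes_inv_inv[OF w] by simp
  with assms(2) show False by simp
qed

lemma word_perm_Nil [simp]: "word_perm [] = id"
  and word_perm_Cons [simp]: "word_perm (i # u) = simple_refl i \<circ> word_perm u"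
  by (simp_all add: word_perm_def)

lemma word_perm_permutes:
  assumes "set u \<subseteq> {1..<n}"
  shows "word_perm u permutes {1..n}"
  using assms
proof (induction u)
  case Nil
  show ?case unfolding word_perm_Nil by (rule permutes_id)
next
  case (Cons i u)
  then show ?case unfolding word_perm_Cons by (intro comp_permutes_simple) auto
qed

lemma inversions_id: "inversions n id = {}"
  by (auto simp: inversions_def)

lemma card_inversions_word_perm_le:
  assumes "set u \<subseteq> {1..<n}"
  shows "card (inversions n (word_perm u)) \<le> length u"
  using assms
proof (induction u)
  case Nil
  show ?case unfolding word_perm_Nil inversions_id by simp
next
  case (Cons i u)
  then have "card (inversions n (simple_refl i \<circ> word_perm u)) \<le> card (inversions n (word_perm u)) + 1"
    by (intro card_inversions_simple_le word_perm_permutes) auto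
  moreover have "card (inversions n (word_perm u)) \<le> length u" using Cons by auto
  ultimately show ?case unfolding word_perm_Cons list.size(4) by linarith
qed

lemma exists_word_of_length_inversions:
  assumes "w permutes {1..n}"
  shows "\<exists>u. set u \<subseteq> {1..<n} \<and> word_perm u = w \<and> length u = card (inversions n w)"
  using assms
proof (induction "card (inversions n w)" arbitrary: w rule: less_induct)
  case less
  show ?case
  proof (cases "w = id")
    case True
    have "card (inversions n w) = 0" unfolding True inversions_id by simp
    with True show ?thesis by (intro exI[of _ "[]"]) simp
  next
    case False
    then obtain i where i: "i \<in> {1..<n}" and desc: "perm_inv w (i + 1) < perm_inv w i"
      using exists_left_descent[OF less.prems] by blast
    note c = card_inversions_simple_down[OF less.prems i desc]
    have "card (inversions n (simple_refl i \<circ> w)) < card (inversions n w)" using c by simp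
    from less.hyps[OF this comp_permutes_simple[OF less.prems i]] obtain u
      where "set u \<subseteq> {1..<n}" "word_perm u = simple_refl i \<circ> w"
        "length u = card (inversions n (simple_refl i \<circ> w))" by blast
    then show ?thesis using i c by (intro exI[of _ "i # u"]) auto
  qed
qed

text \<open>Every letter of a word creates at most one inversion, and removing left descents one by one
  produces a word that attains this bound.\<close>

lemma cox_length_eq_card_inversions:
  assumes "w permutes {1..n}"
  shows "cox_length n w = card (inversions n w)"
  unfolding cox_length_def
proof (rule Least_equality)
  show "\<exists>u. set u \<subseteq> {1..<n} \<and> word_perm u = w \<and> length u = card (inversions n w)"
    by (rule exists_word_of_length_inversions[OF assms])
  show "card (inversions n w) \<le> k"
    if "\<exists>u. set u \<subseteq> {1..<n} \<and> word_perm u = w \<and> length u = k" for k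
    using that card_inversions_word_perm_le by metis
qed

lemma exists_reduced_word:
  assumes "w permutes {1..n}"
  shows "\<exists>u. reduced_word n w u"
  using exists_word_of_length_inversions[OF assms]
  by (auto simp: reduced_word_def cox_length_eq_card_inversions[OF assms])

lemma reduced_word_iff:
  "reduced_word n w u \<longleftrightarrow>
     set u \<subseteq> {1..<n} \<and> word_perm u = w \<and> length u = card (inversions n w)"
  using word_perm_permutes cox_length_eq_card_inversions by (auto simp: reduced_word_def)

section \<open>Independence of the reduced word\<close>

text \<open>Peeling off first letters turns questions about reduced words into questions about left
  descents, which are comparisons of two values of the inverse.\<close>

lemma reduced_word_Cons_iff:
  assumes w: "w permutes {1..n}"
  shows "reduced_word n w (i # u) \<longleftrightarrow>
     i \<in> {1..<n} \<and> perm_inv w (i + 1) < perm_inv w i \<and> reduced_word n (simple_refl i \<circ> w) u"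
    (is "?L \<longleftrightarrow> ?R")
proof
  assume L: ?L
  then have i: "i \<in> {1..<n}" and u: "set u \<subseteq> {1..<n}" and eq: "simple_refl i \<circ> word_perm u = w"
    and len: "length u + 1 = card (inversions n w)"
    by (auto simp: reduced_word_iff)
  have eq': "word_perm u = simple_refl i \<circ> w" using eq by auto
  have le: "card (inversions n (simple_refl i \<circ> w)) \<le> length u"
    using card_inversions_word_perm_le[OF u] by (simp add: eq')
  then have desc: "perm_inv w (i + 1) < perm_inv w i"
    using len by (intro left_descent_if_card_inversions_less[OF w i]) simp
  have "length u = card (inversions n (simple_refl i \<circ> w))"
    using card_inversions_simple_down[OF w i desc] len by simp
  then show ?R using i u eq' desc by (simp add: reduced_word_iff)
next
  assume R: ?R
  then have "card (inversions n w) = card (inversions n (simple_refl i \<circ> w)) + 1"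
    by (intro card_inversions_simple_down[OF w]) auto
  then show ?L using R by (auto simp: reduced_word_iff)
qed

text \<open>Matsumoto's theorem for operators.  Two reduced words with the same first letter are handled by
  induction on the length.  If the first letters are \<open>i < j\<close>, both are left descents of \<open>w\<close>, so \<open>w\<close> has
  reduced words beginning with either side of the braid relation between \<open>i\<close> and \<open>j\<close> and
  continuing with the same remainder \<open>r\<close>.  Each of these is compared with the given word that
  has the same first letter, and the braid relation compares them with each other.\<close>

lemma foldr_reduced_word_unique:
  fixes A :: "nat \<Rightarrow> 'a \<Rightarrow> 'a"
  assumes comm: "\<And>i j x. i \<in> {1..<n} \<Longrightarrow> j \<in> {1..<n} \<Longrightarrow> i + 1 < j \<Longrightarrow> A i (A j x) = A j (A i x)"
    and braid: "\<And>i x. 1 \<le> i \<Longrightarrow> i + 1 < n \<Longrightarrow> A i (A (i + 1) (A i x)) = A (i + 1) (A i (A (i + 1) x))"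
    and w: "w permutes {1..n}" and u: "reduced_word n w u" and u': "reduced_word n w u'"
  shows "foldr A u x = foldr A u' x"
  using w u u'
proof (induction "card (inversions n w)" arbitrary: w u u' x rule: less_induct)
  case less
  note w = less.prems(1)
  have same: "foldr A (i # t) x = foldr A (i # t') x"
    if "reduced_word n w (i # t)" "reduced_word n w (i # t')" for i t t'
  proof -
    from that have i: "i \<in> {1..<n}" and desc: "perm_inv w (i + 1) < perm_inv w i"
      and red: "reduced_word n (simple_refl i \<circ> w) t" "reduced_word n (simple_refl i \<circ> w) t'"
      by (simp_all add: reduced_word_Cons_iff[OF w])
    have "card (inversions n (simple_refl i \<circ> w)) < card (inversions n w)"
      using card_inversions_simple_down[OF w i desc] by simp
    from less.hyps[OF this comp_permutes_simple[OF w i] red] show ?thesis by simp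
  qed
  have diff: "foldr A (i # t) x = foldr A (j # t') x"
    if it: "reduced_word n w (i # t)" and jt: "reduced_word n w (j # t')" and ij: "i < j" for i j t t'
  proof -
    from it jt have i: "i \<in> {1..<n}" and di: "perm_inv w (i + 1) < perm_inv w i"
      and j: "j \<in> {1..<n}" and dj: "perm_inv w (j + 1) < perm_inv w j"
      by (simp_all add: reduced_word_Cons_iff[OF w])
    let ?i = "simple_refl i" and ?j = "simple_refl j"
    note perm = comp_permutes_simple[OF _ i] comp_permutes_simple[OF _ j]
    note red = reduced_word_Cons_iff[OF w] reduced_word_Cons_iff[OF perm(1)]
      reduced_word_Cons_iff[OF perm(2)]
    note inv = inv_simple_comp[OF w]
    note inv' = inv_simple_comp[OF perm(1)[OF w]] inv_simple_comp[OF perm(2)[OF w]]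
    show ?thesis
    proof (cases "j = i + 1")
      case False
      with ij have far: "i + 1 < j" by simp
      have eq: "?i \<circ> (?j \<circ> w) = ?j \<circ> (?i \<circ> w)"
        using far by (auto simp: fun_eq_iff simple_refl_def Transposition.transpose_def)
      have val: "?i j = j" "?i (j + 1) = j + 1" "?j i = i" "?j (i + 1) = i + 1"
        using far by (simp_all add: simple_refl_def)
      obtain r where r: "reduced_word n (?j \<circ> (?i \<circ> w)) r"
        using exists_reduced_word perm w by blast
      have "reduced_word n w (i # j # r)" "reduced_word n w (j # i # r)"
        using r i j di dj unfolding red(1) red(2)[OF w] red(3)[OF w] inv val eq by blast+
      then have "foldr A (i # t) x = foldr A (i # j # r) x"
        "foldr A (j # t') x = foldr A (j # i # r) x"
        using same it jt by blast+
      then show ?thesis using comm[OF i j far] by simp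
    next
      case True
      have eq: "?j \<circ> (?i \<circ> (?j \<circ> w)) = ?i \<circ> (?j \<circ> (?i \<circ> w))"
        using True by (auto simp: fun_eq_iff simple_refl_def Transposition.transpose_def)
      have val: "?i j = i" "?i (j + 1) = j + 1" "?j (i + 1) = j + 1" "?j i = i"
          "?i (i + 1) = i" "?j (j + 1) = j" "?i i = j" "?j j = j + 1"
        using True by (simp_all add: simple_refl_def)
      have dij: "perm_inv w (j + 1) < perm_inv w i" "perm_inv w j < perm_inv w i"
        using di dj True by simp_all
      obtain r where r: "reduced_word n (?i \<circ> (?j \<circ> (?i \<circ> w))) r"
        using exists_reduced_word perm w by blast
      have "reduced_word n w (i # j # i # r)" "reduced_word n w (j # i # j # r)"
        using r i j di dj dij
        unfolding red(1) red(2)[OF w] red(3)[OF w] red(2)[OF perm(2)[OF w]]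
            red(3)[OF perm(1)[OF w]] inv inv' val eq
        by blast+
      then have "foldr A (i # t) x = foldr A (i # j # i # r) x"
        "foldr A (j # t') x = foldr A (j # i # j # r) x"
        using same it jt by blast+
      then show ?thesis using braid[of i] True i j by simp
    qed
  qed
  show ?case
  proof (cases u)
    case Nil
    then have "length u' = 0" using less.prems(2,3) by (simp only: reduced_word_def list.size(3))
    then show ?thesis using Nil by simp
  next
    case (Cons i t)
    then obtain j t' where u': "u' = j # t'"
      using less.prems by (cases u') (simp_all add: reduced_word_def)
    show ?thesis
      using same diff less.prems Cons u' by (metis linorder_neqE_nat)
  qed
qed

section \<open>Bruhat order\<close>

text \<open>Inversions of \<open>w\<close> are mapped injectively to inversions of \<open>w t\<close>, where \<open>t\<close> exchanges the
  positions \<open>a\<close> and \<open>b\<close>: apply \<open>t\<close> to both positions if this keeps them in order, and otherwise leave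
  the pair alone.  An inversion of \<open>w\<close> can fall under the second case only if one of its positions is \<open>a\<close> or \<open>b\<close>
  and the other one lies between them; then \<open>w a < w b\<close> guarantees that it stays an inversion.  The new
  inversion \<open>(a, b)\<close> is missed.\<close>

lemma card_inversions_transpose_less:
  assumes w: "inj w" and a: "1 \<le> a" "a < b" "b \<le> n" and lt: "w a < w b"
  shows "card (inversions n w) < card (inversions n (w \<circ> Transposition.transpose a b))"
proof -
  let ?t = "Transposition.transpose a b"
  define f where "f = (\<lambda>(c, d). if ?t c < ?t d then (?t c, ?t d) else (c, d))"
  have inj: "inj_on f (inversions n w)"
  proof (rule inj_onI)
    fix p p' assume "p \<in> inversions n w" "p' \<in> inversions n w" "f p = f p'"
    then show "p = p'"
      by (auto simp: f_def inversions_def split: if_splits prod.splits)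
        (metis transpose_involutory less_asym)+
  qed
  have "f p \<in> inversions n (w \<circ> ?t)" if "p \<in> inversions n w" for p
    using that a lt by (auto simp: f_def inversions_def Transposition.transpose_def split: if_splits)
  moreover have "(a, b) \<notin> f ` inversions n w"
    using a lt by (auto simp: f_def inversions_def Transposition.transpose_def split: if_splits)
  moreover have "(a, b) \<in> inversions n (w \<circ> ?t)"
    using a lt by (auto simp: inversions_def)
  ultimately have "f ` inversions n w \<subset> inversions n (w \<circ> ?t)" by blast
  then have "card (f ` inversions n w) < card (inversions n (w \<circ> ?t))"
    by (rule psubset_card_mono[OF finite_inversions])
  then show ?thesis by (simp add: card_image[OF inj])
qed

lemma bruhat_le_permutes:
  assumes "bruhat_le n u w"
  shows "u permutes {1..n}" "w permutes {1..n}"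
proof -
  have "u permutes {1..n} \<and> w permutes {1..n}"
    using assms
  proof induction
    case (bruhat_step u w a b)
    then show ?case
      using permutes_compose[OF permutes_swap_id[OF bruhat_step.hyps(2,3)]] by blast
  qed simp
  then show "u permutes {1..n}" "w permutes {1..n}" by auto
qed

lemma bruhat_le_trans:
  assumes "bruhat_le n v w" "bruhat_le n u v"
  shows "bruhat_le n u w"
  using assms by induction (auto intro: bruhat_le.intros)

lemma bruhat_le_transpose_step:
  assumes w: "w permutes {1..n}" and ab: "a \<in> {1..n}" "b \<in> {1..n}" and lt: "a < b" "w a < w b"
  shows "bruhat_le n w (w \<circ> Transposition.transpose a b)"
proof -
  have p: "(w \<circ> Transposition.transpose a b) permutes {1..n}"
    by (rule permutes_compose[OF permutes_swap_id[OF ab] w])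
  have "card (inversions n w) < card (inversions n (w \<circ> Transposition.transpose a b))"
    using ab lt by (intro card_inversions_transpose_less permutes_inj[OF w]) auto
  then have "cox_length n w < cox_length n (w \<circ> Transposition.transpose a b)"
    by (simp only: cox_length_eq_card_inversions[OF w] cox_length_eq_card_inversions[OF p])
  then show ?thesis
    using bruhat_step[OF bruhat_refl[OF w] ab] lt by simp
qed

lemma transpose_length_less_imp_less:
  assumes w: "w permutes {1..n}" and ab: "a \<in> {1..n}" "b \<in> {1..n}" and lt: "a < b"
    and len: "cox_length n w < cox_length n (w \<circ> Transposition.transpose a b)"
  shows "w a < w b"
proof (rule ccontr)
  assume "\<not> ?thesis"
  moreover have "w a \<noteq> w b" using permutes_inj[OF w] lt by (simp add: inj_eq)
  ultimately have gt: "w b < w a" by simp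
  let ?w' = "w \<circ> Transposition.transpose a b"
  have p: "?w' permutes {1..n}"
    by (rule permutes_compose[OF permutes_swap_id[OF ab] w])
  have "card (inversions n ?w') < card (inversions n (?w' \<circ> Transposition.transpose a b))"
    using ab lt gt by (intro card_inversions_transpose_less permutes_inj[OF p]) auto
  moreover have "?w' \<circ> Transposition.transpose a b = w" by (simp add: comp_assoc)
  ultimately have "cox_length n ?w' < cox_length n w"
    by (simp only: cox_length_eq_card_inversions[OF w] cox_length_eq_card_inversions[OF p])
  with len show False by simp
qed

text \<open>The Bruhat relation is generated by reflections acting on the right, whereas the steps of a path
  act on the left; conjugation translates between the two.\<close>

lemma simple_comp_eq_comp_transpose:
  assumes "w permutes {1..n}"
  shows "simple_refl i \<circ> w = w \<circ> Transposition.transpose (perm_inv w i) (perm_inv w (i + 1))"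
proof
  fix k
  have k: "k = perm_inv w j \<longleftrightarrow> w k = j" for j
    using permutes_inv_eq[OF assms, of j k] by auto
  show "(simple_refl i \<circ> w) k
    = (w \<circ> Transposition.transpose (perm_inv w i) (perm_inv w (i + 1))) k"
    unfolding simple_refl_def Transposition.transpose_def comp_apply k
    by (simp add: permutes_inverses[OF assms])
qed

lemma bruhat_le_simple_up:
  assumes w: "w permutes {1..n}" and i: "i \<in> {1..<n}" and up: "perm_inv w i < perm_inv w (i + 1)"
  shows "bruhat_le n w (simple_refl i \<circ> w)"
  unfolding simple_comp_eq_comp_transpose[OF w]
proof (rule bruhat_le_transpose_step[OF w _ _ up])
  show "perm_inv w i \<in> {1..n}" "perm_inv w (i + 1) \<in> {1..n}"
    unfolding permutes_in_image[OF permutes_inv[OF w]] using i by auto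
  show "w (perm_inv w i) < w (perm_inv w (i + 1))"
    using permutes_inverses[OF w] by simp
qed

text \<open>The longer of \<open>w\<close> and \<open>s_i w\<close>, that is, the maximum of the coset of \<open>w\<close> under left
  multiplication by \<open>s_i\<close>.  It serves to state the lifting property as a monotonicity property,
  which avoids a case distinction on the descents of the two permutations involved.\<close>

definition simple_max :: "nat \<Rightarrow> (nat \<Rightarrow> nat) \<Rightarrow> nat \<Rightarrow> nat" where
  "simple_max i w = (if perm_inv w i < perm_inv w (i + 1) then simple_refl i \<circ> w else w)"

lemma bruhat_le_simple_max:
  assumes w: "w permutes {1..n}" and i: "i \<in> {1..<n}"
  shows "bruhat_le n w (simple_max i w)" "bruhat_le n (simple_refl i \<circ> w) (simple_max i w)"
proof -
  note p = comp_permutes_simple[OF w i]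
  have "bruhat_le n w (simple_max i w) \<and> bruhat_le n (simple_refl i \<circ> w) (simple_max i w)"
  proof (cases "perm_inv w i < perm_inv w (i + 1)")
    case True
    then show ?thesis
      using bruhat_le_simple_up[OF w i] bruhat_refl[OF p] by (simp add: simple_max_def)
  next
    case False
    with inv_neq_succ[OF w, of i] have "perm_inv w (i + 1) < perm_inv w i" by linarith
    then have "perm_inv (simple_refl i \<circ> w) i < perm_inv (simple_refl i \<circ> w) (i + 1)"
      unfolding inv_simple_comp[OF w] by (simp add: simple_refl_def)
    from bruhat_le_simple_up[OF p i this] show ?thesis
      using False bruhat_refl[OF w] by (simp add: simple_max_def)
  qed
  then show "bruhat_le n w (simple_max i w)" "bruhat_le n (simple_refl i \<circ> w) (simple_max i w)"
    by auto
qed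

lemma simple_max_simple_comp:
  assumes w: "w permutes {1..n}"
  shows "simple_max i (simple_refl i \<circ> w) = simple_max i w"
proof -
  have "perm_inv (simple_refl i \<circ> w) i = perm_inv w (i + 1)"
    "perm_inv (simple_refl i \<circ> w) (i + 1) = perm_inv w i"
    unfolding inv_simple_comp[OF w] by (simp_all add: simple_refl_def)
  then show ?thesis
    using inv_neq_succ[OF w, of i] unfolding simple_max_def by auto
qed

text \<open>Write \<open>w' = w t\<close>.  If \<open>t\<close> exchanges the values \<open>i\<close> and \<open>i + 1\<close>, then \<open>w' = s_i w\<close> and the two
  cosets agree.  Otherwise \<open>s_i\<close> does not disturb the comparison of the two exchanged values, so
  that \<open>s_i w \<le> s_i w'\<close> as well as \<open>w \<le> w'\<close>, and both right-hand sides lie below the maximum of the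
  coset of \<open>w'\<close>.\<close>

lemma simple_max_mono_transpose:
  assumes w: "w permutes {1..n}" and i: "i \<in> {1..<n}"
    and ab: "a \<in> {1..n}" "b \<in> {1..n}" "a < b" "w a < w b"
  shows "bruhat_le n (simple_max i w) (simple_max i (w \<circ> Transposition.transpose a b))"
proof -
  let ?w' = "w \<circ> Transposition.transpose a b" and ?sw = "simple_refl i \<circ> w"
  have w': "?w' permutes {1..n}"
    by (rule permutes_compose[OF permutes_swap_id[OF ab(1,2)] w])
  note sw = comp_permutes_simple[OF w i]
  show ?thesis
  proof (cases "{w a, w b} = {i, i + 1}")
    case True
    with ab have "w a = i" "w b = i + 1" by (auto simp: doubleton_eq_iff)
    then have "perm_inv w i = a" "perm_inv w (i + 1) = b" using permutes_inverses(2)[OF w] by metis+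
    then have eq: "?w' = ?sw" by (simp only: simple_comp_eq_comp_transpose[OF w])
    have "simple_max i w permutes {1..n}"
      using w sw by (simp add: simple_max_def)
    then show ?thesis unfolding eq simple_max_simple_comp[OF w] by (rule bruhat_refl)
  next
    case False
    then have "simple_refl i (w a) < simple_refl i (w b)"
      using ab(4) simple_refl_less_iff by blast
    then have "bruhat_le n ?sw (?sw \<circ> Transposition.transpose a b)"
      using ab by (intro bruhat_le_transpose_step[OF sw]) auto
    then have 1: "bruhat_le n ?sw (simple_max i ?w')"
      using bruhat_le_trans[OF bruhat_le_simple_max(2)[OF w' i]] by (simp only: comp_assoc)
    have "bruhat_le n w ?w'"
      using ab by (intro bruhat_le_transpose_step[OF w]) auto
    then have 2: "bruhat_le n w (simple_max i ?w')"
      by (rule bruhat_le_trans[OF bruhat_le_simple_max(1)[OF w' i]])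
    from 1 2 show ?thesis by (simp add: simple_max_def[of i w])
  qed
qed

lemma simple_max_mono:
  assumes "bruhat_le n u w" and i: "i \<in> {1..<n}"
  shows "bruhat_le n (simple_max i u) (simple_max i w)"
  using assms(1)
proof induction
  case (bruhat_refl w)
  then have "simple_max i w permutes {1..n}"
    using comp_permutes_simple[OF _ i] by (simp add: simple_max_def)
  then show ?case by (rule bruhat_le.bruhat_refl)
next
  case (bruhat_step u w a b)
  then have w: "w permutes {1..n}" using bruhat_le_permutes by blast
  have "bruhat_le n (simple_max i w) (simple_max i (w \<circ> Transposition.transpose a b))"
  proof (cases "a < b")
    case True
    then show ?thesis
      using bruhat_step.hyps transpose_length_less_imp_less[OF w]
      by (intro simple_max_mono_transpose[OF w i]) blast+
  next
    case False
    with bruhat_step.hyps have "b < a" by simp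
    then have "bruhat_le n (simple_max i w) (simple_max i (w \<circ> Transposition.transpose b a))"
      using bruhat_step.hyps transpose_length_less_imp_less[OF w, of b a]
      by (intro simple_max_mono_transpose[OF w i]) (simp_all add: transpose_commute)
    then show ?thesis by (simp add: transpose_commute)
  qed
  then show ?case using bruhat_step.IH bruhat_le_trans by blast
qed

text \<open>The lifting property, in the form needed for paths: when \<open>s_i\<close> lengthens \<open>w\<close>, the product
  \<open>s_i w\<close> is the maximum of its coset and dominates the whole coset of \<open>u\<close>.\<close>

lemma bruhat_le_lift:
  assumes uw: "bruhat_le n u w" and i: "i \<in> {1..<n}" and up: "perm_inv w i < perm_inv w (i + 1)"
  shows "bruhat_le n u (simple_refl i \<circ> w)" "bruhat_le n (simple_refl i \<circ> u) (simple_refl i \<circ> w)"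
proof -
  have u: "u permutes {1..n}" using bruhat_le_permutes[OF uw] by simp
  have "bruhat_le n (simple_max i u) (simple_refl i \<circ> w)"
    using simple_max_mono[OF uw i] up by (simp add: simple_max_def[of i w])
  then show "bruhat_le n u (simple_refl i \<circ> w)" "bruhat_le n (simple_refl i \<circ> u) (simple_refl i \<circ> w)"
    using bruhat_le_simple_max[OF u i] bruhat_le_trans by blast+
qed

section \<open>Standard tableaux\<close>

lemma finite_boxes: "finite (boxes lam mu)"
proof -
  have "diagram lam \<subseteq> {1..int (length lam)} \<times> {1..int (sum_list lam)}"
  proof
    fix b assume "b \<in> diagram lam"
    then obtain x y where b: "b = (x, y)" "1 \<le> x" "x \<le> int (length lam)" "1 \<le> y"
      "y \<le> int (lam ! nat (x - 1))"
      by (auto simp: diagram_def)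
    then have "lam ! nat (x - 1) \<in> set lam" by (intro nth_mem) linarith
    then have "lam ! nat (x - 1) \<le> sum_list lam" by (rule member_le_sum_list) simp
    with b show "b \<in> {1..int (length lam)} \<times> {1..int (sum_list lam)}" by simp
  qed
  then have "finite (diagram lam)" by (rule finite_subset) simp
  then show ?thesis by (simp add: boxes_def)
qed

lemma finite_SYT:
  assumes "finite D"
  shows "finite (SYT D)"
proof (rule finite_subset)
  show "SYT D \<subseteq> {T. \<forall>b. (b \<in> D \<longrightarrow> T b \<in> {1..card D}) \<and> (b \<notin> D \<longrightarrow> T b = 0)}"
    by (auto simp: SYT_def young_tableau_def dest: bij_betwE)
  show "finite {T. \<forall>b. (b \<in> D \<longrightarrow> T b \<in> {1..card D}) \<and> (b \<notin> D \<longrightarrow> T b = (0::nat))}"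
    using assms by (intro finite_set_of_finite_funs) auto
qed

lemma SYT_young_tableau: "T \<in> SYT D \<Longrightarrow> young_tableau D T"
  by (simp add: SYT_def)

text \<open>The entry of a box counts the boxes up to it in the order by columns, and the set that is
  counted grows strictly along this order.\<close>

lemma column_tableau_less:
  assumes D: "finite D" and b: "b \<in> D" "b' \<in> D"
    and less: "snd b < snd b' \<or> snd b = snd b' \<and> fst b < fst b'"
  shows "column_tableau D b < column_tableau D b'"
proof -
  obtain x y x' y' where eq: "b = (x, y)" "b' = (x', y')" by (cases b; cases b') auto
  let ?before = "\<lambda>x y. {(s, t). (s, t) \<in> D \<and> (t < y \<or> t = y \<and> s \<le> x)}"
  have "finite (?before x' y')" by (rule finite_subset[OF _ D]) auto
  moreover have "?before x y \<subset> ?before x' y'"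
  proof
    show "?before x y \<subseteq> ?before x' y'" using less eq by auto
    have "(x', y') \<in> ?before x' y'" "(x', y') \<notin> ?before x y" using less b eq by auto
    then show "?before x y \<noteq> ?before x' y'" by blast
  qed
  ultimately have "card (?before x y) < card (?before x' y')" by (rule psubset_card_mono)
  then show ?thesis using b by (simp add: column_tableau_def eq)
qed

lemma column_tableau_bij:
  assumes D: "finite D"
  shows "bij_betw (column_tableau D) D {1..card D}"
proof -
  have inj: "inj_on (column_tableau D) D"
  proof (rule inj_onI)
    fix b b' assume b: "b \<in> D" "b' \<in> D" and eq: "column_tableau D b = column_tableau D b'"
    show "b = b'"
    proof (rule ccontr)
      assume "b \<noteq> b'"
      then have "fst b \<noteq> fst b' \<or> snd b \<noteq> snd b'" by (auto simp: prod_eq_iff)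
      then have "(snd b < snd b' \<or> snd b = snd b' \<and> fst b < fst b') \<or>
        (snd b' < snd b \<or> snd b' = snd b \<and> fst b' < fst b)" by linarith
      then consider "snd b < snd b' \<or> snd b = snd b' \<and> fst b < fst b'"
        | "snd b' < snd b \<or> snd b' = snd b \<and> fst b' < fst b" by blast
      then show False
        using column_tableau_less[OF D b] column_tableau_less[OF D b(2,1)] eq by cases auto
    qed
  qed
  have "column_tableau D ` D \<subseteq> {1..card D}"
  proof
    fix k assume "k \<in> column_tableau D ` D"
    then obtain x y where xy: "(x, y) \<in> D" and k: "k = column_tableau D (x, y)" by auto
    let ?before = "{(s, t). (s, t) \<in> D \<and> (t < y \<or> t = y \<and> s \<le> x)}"
    have sub: "?before \<subseteq> D" by auto
    have "(x, y) \<in> ?before" using xy by simp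
    then have "card ?before \<noteq> 0" using finite_subset[OF sub D] by auto
    moreover have "card ?before \<le> card D" by (rule card_mono[OF D sub])
    ultimately show "k \<in> {1..card D}" using xy k by (simp add: column_tableau_def)
  qed
  then have "column_tableau D ` D = {1..card D}"
    by (intro card_subset_eq) (simp_all add: card_image[OF inj])
  with inj show ?thesis by (simp add: bij_betw_def)
qed

lemma column_tableau_outside: "b \<notin> D \<Longrightarrow> column_tableau D b = 0"
  by (cases b) (simp add: column_tableau_def)

lemma column_tableau_SYT:
  assumes "finite D"
  shows "column_tableau D \<in> SYT D"
  using column_tableau_bij[OF assms] column_tableau_less[OF assms]
  by (auto simp: SYT_def young_tableau_def column_tableau_outside)

lemma tab_perm_eqI:
  assumes D: "finite D" and w: "w permutes {1..card D}" and act: "tab_act w (column_tableau D) = T"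
  shows "tab_perm D T = w"
  unfolding tab_perm_def
proof (rule the_equality)
  show "w permutes {1..card D} \<and> tab_act w (column_tableau D) = T" using w act by simp
next
  fix w' assume w': "w' permutes {1..card D} \<and> tab_act w' (column_tableau D) = T"
  show "w' = w"
  proof
    fix k
    show "w' k = w k"
    proof (cases "k \<in> {1..card D}")
      case True
      then obtain b where "k = column_tableau D b"
        using bij_betw_imp_surj_on[OF column_tableau_bij[OF D]] by blast
      then show ?thesis using w' act by (metis comp_apply tab_act_def)
    next
      case False
      then show ?thesis using w w' by (metis permutes_not_in)
    qed
  qed
qed

lemma tab_perm_properties:
  assumes D: "finite D" and T: "young_tableau D T"
  shows "tab_perm D T permutes {1..card D}" "tab_act (tab_perm D T) (column_tableau D) = T"
proof -
  let ?C = "column_tableau D"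
  define w where "w = (\<lambda>k. if k \<in> {1..card D} then T (inv_into D ?C k) else k)"
  have "bij_betw (T \<circ> inv_into D ?C) {1..card D} {1..card D}"
    using bij_betw_trans[OF bij_betw_inv_into[OF column_tableau_bij[OF D]]] T
    by (auto simp: young_tableau_def)
  then have "bij_betw w {1..card D} {1..card D}"
    by (rule bij_betw_cong[THEN iffD1, rotated]) (simp add: w_def)
  then have w: "w permutes {1..card D}" by (rule bij_imp_permutes) (simp only: w_def if_False)
  have "w (?C b) = T b" for b
  proof (cases "b \<in> D")
    case True
    then have "?C b \<in> {1..card D}" "inv_into D ?C (?C b) = b"
      using column_tableau_bij[OF D] by (auto simp: bij_betw_def)
    then show ?thesis by (simp only: w_def if_True)
  next
    case False
    then have "T b = 0" using T unfolding young_tableau_def by blast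
    then show ?thesis by (simp add: w_def column_tableau_outside[OF False])
  qed
  then have act: "tab_act w ?C = T" by (simp add: tab_act_def fun_eq_iff)
  from tab_perm_eqI[OF D w act] w act
  show "tab_perm D T permutes {1..card D}" "tab_act (tab_perm D T) ?C = T" by simp_all
qed

lemma tab_perm_column_tableau:
  assumes "finite D"
  shows "tab_perm D (column_tableau D) = id"
  by (rule tab_perm_eqI[OF assms permutes_id]) (simp add: tab_act_def)

lemma tab_perm_simple:
  assumes D: "finite D" and T: "young_tableau D T" and i: "i \<in> {1..<card D}"
  shows "tab_perm D (tab_act (simple_refl i) T) = simple_refl i \<circ> tab_perm D T"
proof (rule tab_perm_eqI[OF D comp_permutes_simple[OF tab_perm_properties(1)[OF D T] i]])
  show "tab_act (simple_refl i \<circ> tab_perm D T) (column_tableau D) = tab_act (simple_refl i) T"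
    using tab_perm_properties(2)[OF D T] by (simp add: tab_act_def comp_assoc)
qed

text \<open>The inverse of \<open>w_T\<close> reads off the column reading number of the box that contains a given
  entry.  A left descent \<open>i\<close> of \<open>w_T\<close> therefore says that \<open>i + 1\<close> comes before \<open>i\<close> in column reading
  order.\<close>

lemma perm_inv_tab_perm:
  assumes "finite D" "young_tableau D T"
  shows "perm_inv (tab_perm D T) (T b) = column_tableau D b"
proof -
  have "tab_perm D T (column_tableau D b) = T b"
    using tab_perm_properties(2)[OF assms] by (metis comp_apply tab_act_def)
  then show ?thesis using permutes_inverses(2)[OF tab_perm_properties(1)[OF assms]] by metis
qed

lemma tab_act_simple_twice [simp]: "tab_act (simple_refl i) (tab_act (simple_refl i) T) = T"
  by (simp add: tab_act_def fun_eq_iff)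

text \<open>Exchanging \<open>i\<close> and \<open>i + 1\<close> could violate standardness only if they shared a row or a column.
  But there \<open>i\<close> would precede \<open>i + 1\<close> in both \<open>T\<close> and \<open>C\<close>, contrary to the descent.\<close>

lemma SYT_descend:
  assumes D: "finite D" and T: "T \<in> SYT D" and i: "i \<in> {1..<card D}"
    and desc: "perm_inv (tab_perm D T) (i + 1) < perm_inv (tab_perm D T) i"
  shows "tab_act (simple_refl i) T \<in> SYT D"
proof -
  note yT = SYT_young_tableau[OF T]
  have keep: "simple_refl i (T b) < simple_refl i (T b')"
    if lt: "T b < T b'" and C: "column_tableau D b < column_tableau D b'" for b b'
  proof -
    \<comment> \<open>the only comparison that \<open>s_i\<close> reverses is excluded by the descent\<close>
    have "{T b, T b'} \<noteq> {i, i + 1}"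
    proof
      assume "{T b, T b'} = {i, i + 1}"
      with lt have "T b = i" "T b' = i + 1" by (auto simp: doubleton_eq_iff)
      then have "column_tableau D b' < column_tableau D b"
        using desc perm_inv_tab_perm[OF D yT] by metis
      with C show False by simp
    qed
    with lt show ?thesis using simple_refl_less_iff by blast
  qed
  have "bij_betw (simple_refl i \<circ> T) D {1..card D}"
    using yT permutes_imp_bij[OF simple_refl_permutes[OF i]]
    by (auto simp: young_tableau_def intro: bij_betw_trans)
  moreover have "(simple_refl i \<circ> T) b = 0" if "b \<notin> D" for b
  proof -
    have "T b = 0" using that yT unfolding young_tableau_def by blast
    then show ?thesis using i by (simp add: simple_refl_def Transposition.transpose_def)
  qed
  ultimately have "young_tableau D (simple_refl i \<circ> T)" by (simp add: young_tableau_def)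
  moreover have "simple_refl i (T (x, y)) < simple_refl i (T (x, y'))"
    if "(x, y) \<in> D" "(x, y') \<in> D" "y < y'" for x y y'
    using that T column_tableau_less[OF D that(1,2)] by (intro keep) (auto simp: SYT_def)
  moreover have "simple_refl i (T (x, y)) < simple_refl i (T (x', y))"
    if "(x, y) \<in> D" "(x', y) \<in> D" "x < x'" for x x' y
    using that T column_tableau_less[OF D that(1,2)] by (intro keep) (auto simp: SYT_def)
  ultimately show ?thesis by (simp add: SYT_def tab_act_def)
qed

section \<open>Paths from the column reading tableau\<close>

lemma is_path_last:
  assumes "is_path D S T u Ts"
  shows "Ts ! length u = T"
  using assms last_conv_nth[of Ts] by (cases "Ts = []") (auto simp: is_path_def)

lemma is_path_snoc:
  assumes path: "is_path D S T u Ts" and i: "i \<in> {1..<card D}" and T': "tab_act (simple_refl i) T \<in> SYT D"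
  shows "is_path D S (tab_act (simple_refl i) T) (u @ [i]) (Ts @ [tab_act (simple_refl i) T])"
proof -
  have len: "length Ts = length u + 1" and ne: "Ts \<noteq> []"
    using path by (auto simp: is_path_def)
  note last = is_path_last[OF path]
  show ?thesis
    using path i T' last ne
    by (auto simp: is_path_def len nth_append hd_append less_Suc_eq)
qed

lemma exists_reduced_path:
  assumes D: "finite D" and T: "T \<in> SYT D"
  shows "\<exists>u Ts. is_path D (column_tableau D) T u Ts \<and> length u = cox_length (card D) (tab_perm D T)"
  using T
proof (induction "cox_length (card D) (tab_perm D T)" arbitrary: T rule: less_induct)
  case less
  note yT = SYT_young_tableau[OF less.prems]
  note w = tab_perm_properties[OF D yT]
  show ?case
  proof (cases "tab_perm D T = id")
    case True
    have "cox_length (card D) (tab_perm D T) = 0"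
      unfolding cox_length_eq_card_inversions[OF w(1)] unfolding True inversions_id by simp
    moreover have "T = column_tableau D" using w(2) True by (simp add: tab_act_def)
    ultimately have "is_path D (column_tableau D) T [] [T] \<and>
        length ([] :: nat list) = cox_length (card D) (tab_perm D T)"
      using less.prems by (simp add: is_path_def)
    then show ?thesis by blast
  next
    case False
    then obtain i where i: "i \<in> {1..<card D}"
      and desc: "perm_inv (tab_perm D T) (i + 1) < perm_inv (tab_perm D T) i"
      using exists_left_descent[OF w(1)] by blast
    let ?T' = "tab_act (simple_refl i) T"
    have len: "cox_length (card D) (tab_perm D T) = cox_length (card D) (tab_perm D ?T') + 1"
      unfolding tab_perm_simple[OF D yT i] cox_length_eq_card_inversions[OF w(1)]
        cox_length_eq_card_inversions[OF comp_permutes_simple[OF w(1) i]]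
      by (rule card_inversions_simple_down[OF w(1) i desc])
    have T': "?T' \<in> SYT D" by (rule SYT_descend[OF D less.prems i desc])
    from len have "cox_length (card D) (tab_perm D ?T') < cox_length (card D) (tab_perm D T)" by simp
    from less.hyps[OF this T'] obtain u Ts
      where u: "is_path D (column_tableau D) ?T' u Ts"
        "length u = cox_length (card D) (tab_perm D ?T')" by blast
    have "is_path D (column_tableau D) T (u @ [i]) (Ts @ [T])"
      using is_path_snoc[OF u(1) i] less.prems by simp
    moreover have "length (u @ [i]) = cox_length (card D) (tab_perm D T)" using len u(2) by simp
    ultimately show ?thesis by blast
  qed
qed

lemma is_path_nth_SYT:
  assumes "is_path D S T u Ts" "j \<le> length u"
  shows "Ts ! j \<in> SYT D"
proof -
  have "j < length Ts" "set Ts \<subseteq> SYT D" using assms by (auto simp: is_path_def)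
  then show ?thesis by auto
qed

lemma is_path_nth_label:
  assumes "is_path D S T u Ts" "j < length u"
  shows "u ! j \<in> {1..<card D}"
  using nth_mem[OF assms(2)] assms(1) unfolding is_path_def by blast

lemma tab_perm_path:
  assumes D: "finite D" and path: "is_path D (column_tableau D) T u Ts" and "j \<le> length u"
  shows "tab_perm D (Ts ! j) = word_perm (rev (take j u))"
  using assms(3)
proof (induction j)
  case 0
  have "Ts ! 0 = column_tableau D" using path by (cases Ts) (auto simp: is_path_def)
  then show ?case using tab_perm_column_tableau[OF D] by simp
next
  case (Suc j)
  then have "Ts ! Suc j = tab_act (simple_refl (u ! j)) (Ts ! j)" "u ! j \<in> {1..<card D}"
    using path is_path_nth_label[OF path, of j] by (auto simp: is_path_def)
  then have "tab_perm D (Ts ! Suc j) = simple_refl (u ! j) \<circ> tab_perm D (Ts ! j)"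
    using tab_perm_simple[OF D SYT_young_tableau[OF is_path_nth_SYT[OF path]]] Suc by simp
  then show ?case using Suc by (simp add: take_Suc_conv_app_nth)
qed

lemma path_reduced_word:
  assumes D: "finite D" and path: "is_path D (column_tableau D) T u Ts"
    and len: "length u = cox_length (card D) (tab_perm D T)"
  shows "reduced_word (card D) (tab_perm D T) (rev u)"
proof -
  have "tab_perm D T = word_perm (rev u)" 
    using tab_perm_path[OF D path, of "length u"] is_path_last[OF path] by simp
  then show ?thesis using len path by (simp add: reduced_word_def is_path_def)
qed

lemma reduced_word_suffix:
  assumes "reduced_word n w (u @ u')"
  shows "reduced_word n (word_perm u') u'"
  using assms
proof (induction u arbitrary: w)
  case Nil
  then show ?case by (auto simp: reduced_word_def)
next
  case (Cons i u)
  then have "w permutes {1..n}" using word_perm_permutes unfolding reduced_word_def by blast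
  then have "reduced_word n (simple_refl i \<circ> w) (u @ u')"
    using Cons.prems reduced_word_Cons_iff[of w n i "u @ u'"] by simp
  then show ?case by (rule Cons.IH)
qed

text \<open>The labels of an initial segment, reversed, form a suffix of the reduced word of the whole path;
  suffixes of reduced words are reduced, so that no step of the path decreases the length.\<close>

lemma reduced_path_ascends:
  assumes D: "finite D" and path: "is_path D (column_tableau D) T u Ts"
    and len: "length u = cox_length (card D) (tab_perm D T)" and j: "j < length u"
  shows "perm_inv (tab_perm D (Ts ! j)) (u ! j) < perm_inv (tab_perm D (Ts ! j)) (u ! j + 1)"
proof -
  let ?w = "word_perm (rev (take j u))" and ?i = "u ! j"
  have "rev u = rev (drop (Suc j) u) @ ?i # rev (take j u)"
    by (metis append.assoc append_Cons append_Nil append_take_drop_id j rev.simps(2) rev_append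
        rev_rev_ident take_Suc_conv_app_nth)
  then have red: "reduced_word (card D) (simple_refl ?i \<circ> ?w) (?i # rev (take j u))"
    using reduced_word_suffix path_reduced_word[OF D path len] by (metis word_perm_Cons)
  have i: "?i \<in> {1..<card D}" and t: "set (rev (take j u)) \<subseteq> {1..<card D}"
    using is_path_nth_label[OF path j] path set_take_subset[of j u] by (auto simp: is_path_def)
  note w = word_perm_permutes[OF t]
  have "perm_inv (simple_refl ?i \<circ> ?w) (?i + 1) < perm_inv (simple_refl ?i \<circ> ?w) ?i"
    using red reduced_word_Cons_iff[OF comp_permutes_simple[OF w i]] by blast
  then have "perm_inv ?w ?i < perm_inv ?w (?i + 1)"
    unfolding inv_simple_comp[OF w] by (simp add: simple_refl_def)
  then show ?thesis using tab_perm_path[OF D path, of j] j by simp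
qed

lemma subpath_bruhat_le:
  assumes D: "finite D" and path: "is_path D (column_tableau D) T u Ts"
    and len: "length u = cox_length (card D) (tab_perm D T)"
    and sub: "(zs, Ss) \<in> subpaths D u Ts"
  shows "tab_le D (last Ss) T"
proof -
  have "bruhat_le (card D) (tab_perm D (Ss ! j)) (tab_perm D (Ts ! j))" if "j \<le> length u" for j
    using that
  proof (induction j)
    case 0
    have "Ss ! 0 = column_tableau D" "Ts ! 0 = column_tableau D"
      using path sub hd_conv_nth[of Ss] hd_conv_nth[of Ts]
      by (cases Ss; cases Ts; auto simp: is_path_def subpaths_def)+
    then show ?case
      using tab_perm_column_tableau[OF D] bruhat_refl[OF permutes_id] by metis
  next
    case (Suc j)
    then have j: "j < length u" by simp
    note i = is_path_nth_label[OF path j]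
    have T: "Ts ! Suc j = tab_act (simple_refl (u ! j)) (Ts ! j)"
      using path j by (auto simp: is_path_def)
    have yT: "young_tableau D (Ts ! j)"
      using is_path_nth_SYT[OF path] j by (intro SYT_young_tableau) simp
    have yS: "young_tableau D (Ss ! j)"
    proof (intro SYT_young_tableau)
      have "j < length Ss" "set Ss \<subseteq> SYT D" using sub j by (auto simp: subpaths_def)
      then show "Ss ! j \<in> SYT D" by auto
    qed
    have S: "Ss ! Suc j = Ss ! j \<or> Ss ! Suc j = tab_act (simple_refl (u ! j)) (Ss ! j)"
      using sub j by (fastforce simp: subpaths_def tab_act_def)
    have IH: "bruhat_le (card D) (tab_perm D (Ss ! j)) (tab_perm D (Ts ! j))" using Suc by simp
    show ?case
      using S bruhat_le_lift[OF IH i reduced_path_ascends[OF D path len j]]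
        tab_perm_simple[OF D yT i] tab_perm_simple[OF D yS i] T by metis
  qed
  from this[of "length u"] show ?thesis
    using is_path_last[OF path] sub last_conv_nth[of Ss]
    by (cases "Ss = []") (auto simp: tab_le_def subpaths_def)
qed

section \<open>The Hecke algebra acting on the module\<close>

lemma carrier_free_hecke:
  "f \<in> carrier (free_hecke n) \<longleftrightarrow> (\<forall>w \<in> Poly_Mapping.keys f. set (letters w) \<subseteq> hecke_gens n)"
  by (simp add: free_hecke_def)

lemma free_hecke_simps [simp]:
  "mult (free_hecke n) = (*)" "add (free_hecke n) = (+)" "one (free_hecke n) = 1"
  "zero (free_hecke n) = 0"
  by (simp_all add: free_hecke_def)

lemma free_hecke_mult_closed:
  "f \<in> carrier (free_hecke n) \<Longrightarrow> g \<in> carrier (free_hecke n) \<Longrightarrow> f * g \<in> carrier (free_hecke n)"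
  using ring.ring_simprules(5)[OF free_hecke_ring] by simp

lemma free_hecke_add_closed:
  "f \<in> carrier (free_hecke n) \<Longrightarrow> g \<in> carrier (free_hecke n) \<Longrightarrow> f + g \<in> carrier (free_hecke n)"
  using ring.ring_simprules(1)[OF free_hecke_ring] by simp

lemma free_hecke_diff_closed:
  "f \<in> carrier (free_hecke n) \<Longrightarrow> g \<in> carrier (free_hecke n) \<Longrightarrow> f - g \<in> carrier (free_hecke n)"
  using keys_diff[of f g] unfolding carrier_free_hecke by fast

lemma free_hecke_generators:
  "1 \<in> carrier (free_hecke n)" "fscal a \<in> carrier (free_hecke n)"
  "i \<in> {1..<n} \<Longrightarrow> fT i \<in> carrier (free_hecke n)"
  "i \<in> {1..n} \<Longrightarrow> fX i \<in> carrier (free_hecke n)"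
  by (auto simp: carrier_free_hecke fT_def fX_def fscal_def hecke_gens_def zero_hecke_word_def)

lemma free_hecke_minus:
  assumes "f \<in> carrier (free_hecke n)" "g \<in> carrier (free_hecke n)"
  shows "f \<ominus>\<^bsub>free_hecke n\<^esub> g = f - g"
proof -
  interpret ring "free_hecke n" by (rule free_hecke_ring)
  have "0 - g \<in> carrier (free_hecke n)"
    using free_hecke_diff_closed[OF zero_closed assms(2)] by simp
  then have "\<ominus>\<^bsub>free_hecke n\<^esub> g = - g"
    using minus_equality[of "- g" g] assms(2) by simp
  then show ?thesis by (simp add: a_minus_def)
qed

lemma hecke_ideal_ideal: "ideal (hecke_ideal n q) (free_hecke n)"
proof -
  have "hecke_relators n q \<subseteq> carrier (free_hecke n)"
    unfolding hecke_relators_def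
    by (intro Un_least)
      (auto split: if_splits
        intro!: free_hecke_diff_closed free_hecke_mult_closed free_hecke_add_closed
          free_hecke_generators)
  then show ?thesis
    unfolding hecke_ideal_def by (rule ring.genideal_ideal[OF free_hecke_ring])
qed

lemma hecke_relators_subset_ideal: "hecke_relators n q \<subseteq> hecke_ideal n q"
  unfolding hecke_ideal_def genideal_def by blast

lemma hecke_class_closed:
  assumes "f \<in> carrier (free_hecke n)"
  shows "hecke_class n q f \<in> carrier (affine_hecke n q)"
proof -
  interpret ideal "hecke_ideal n q" "free_hecke n" by (rule hecke_ideal_ideal)
  show ?thesis
    using assms a_rcosetsI[OF a_subset]
    by (simp add: affine_hecke_def FactRing_def hecke_class_def)
qed

lemma hecke_class_mult:
  assumes "f \<in> carrier (free_hecke n)" "g \<in> carrier (free_hecke n)"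
  shows "hecke_class n q f \<otimes>\<^bsub>affine_hecke n q\<^esub> hecke_class n q g = hecke_class n q (f * g)"
  using ideal.rcoset_mult_add[OF hecke_ideal_ideal assms]
  by (simp add: affine_hecke_def FactRing_def hecke_class_def)

lemma hecke_class_eqI:
  assumes "f \<in> carrier (free_hecke n)" "g \<in> carrier (free_hecke n)" "f - g \<in> hecke_relators n q"
  shows "hecke_class n q f = hecke_class n q g"
proof -
  have "f \<ominus>\<^bsub>free_hecke n\<^esub> g \<in> hecke_ideal n q"
    using assms hecke_relators_subset_ideal by (auto simp: free_hecke_minus)
  then show ?thesis
    using ring.quotient_eq_iff_same_a_r_cos[OF free_hecke_ring hecke_ideal_ideal assms(1,2)]
    by (simp add: hecke_class_def)
qed

text \<open>Scalars sit at the empty word and are therefore central already in the free algebra.  This makes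
  the operators \<open>T_i\<close> linear.\<close>

lemma fscal_commute_fT: "fscal a * fT i = fT i * fscal a"
  by (simp add: fscal_def fT_def mult_single)

context hecke_module
begin

definition T_op :: "nat \<Rightarrow> 'v \<Rightarrow> 'v" where
  "T_op i = act (hecke_T n q i)"

lemma T_closed: "i \<in> {1..<n} \<Longrightarrow> hecke_T n q i \<in> carrier (affine_hecke n q)"
  unfolding hecke_T_def by (intro hecke_class_closed free_hecke_generators)

lemma act_class_mult:
  assumes "f \<in> carrier (free_hecke n)" "g \<in> carrier (free_hecke n)"
  shows "act (hecke_class n q f) (act (hecke_class n q g) x) = act (hecke_class n q (f * g)) x"
  unfolding hecke_class_mult[OF assms, symmetric]
  by (intro act_mult[symmetric] hecke_class_closed assms)

lemma T_op_add:
  assumes "i \<in> {1..<n}"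
  shows "T_op i (x + y) = T_op i x + T_op i y"
  unfolding T_op_def by (rule act_add_right[OF T_closed[OF assms]])

lemma T_op_scale:
  assumes "i \<in> {1..<n}"
  shows "T_op i (scale a x) = scale a (T_op i x)"
  unfolding T_op_def hecke_T_def act_scal[symmetric] hecke_scal_def
  using assms by (simp only: act_class_mult free_hecke_generators fscal_commute_fT)

lemma T_op_commute:
  assumes "i \<in> {1..<n}" "j \<in> {1..<n}" "i + 1 < j"
  shows "T_op i (T_op j x) = T_op j (T_op i x)"
proof -
  have "fT i * fT j - fT j * fT i \<in> hecke_relators n q"
    using assms unfolding hecke_relators_def by fastforce
  then have "hecke_class n q (fT i * fT j) = hecke_class n q (fT j * fT i)"
    using assms by (intro hecke_class_eqI free_hecke_mult_closed free_hecke_generators)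
  then show ?thesis
    using assms by (simp only: T_op_def hecke_T_def act_class_mult free_hecke_generators)
qed

lemma T_op_braid:
  assumes "1 \<le> i" "i + 1 < n"
  shows "T_op i (T_op (i + 1) (T_op i x)) = T_op (i + 1) (T_op i (T_op (i + 1) x))"
proof -
  have ij: "i \<in> {1..<n}" "i + 1 \<in> {1..<n}" using assms by auto
  have "fT i * fT (i + 1) * fT i - fT (i + 1) * fT i * fT (i + 1) \<in> hecke_relators n q"
    using assms unfolding hecke_relators_def by blast
  then have "hecke_class n q (fT i * fT (i + 1) * fT i) = hecke_class n q (fT (i + 1) * fT i * fT (i + 1))"
    using ij by (intro hecke_class_eqI free_hecke_mult_closed free_hecke_generators)
  then show ?thesis
    unfolding T_op_def hecke_T_def
    using ij by (simp only: act_class_mult free_hecke_generators free_hecke_mult_closed mult.assoc)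
qed

text \<open>The element \<open>T_w\<close> is formed from an arbitrarily chosen reduced word.  The braid relations allow
  it to be computed from the word that a given path supplies.\<close>

lemma act_hecke_Tw:
  assumes w: "w permutes {1..n}" and u: "reduced_word n w u"
  shows "act (hecke_Tw n q w) x = foldr T_op u x"
proof -
  interpret A: ring "affine_hecke n q" by (rule affine_hecke_ring)
  define r where "r = (SOME r. reduced_word n w r)"
  have r: "reduced_word n w r" unfolding r_def using u by (rule someI)
  let ?prod = "\<lambda>t. foldr (\<lambda>i h. hecke_T n q i \<otimes>\<^bsub>affine_hecke n q\<^esub> h) t \<one>\<^bsub>affine_hecke n q\<^esub>"
  have "?prod t \<in> carrier (affine_hecke n q) \<and> act (?prod t) x = foldr T_op t x"
    if "set t \<subseteq> {1..<n}" for t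
    using that
  proof (induction t)
    case Nil
    then show ?case by (simp add: act_one)
  next
    case (Cons i t)
    then have "hecke_T n q i \<in> carrier (affine_hecke n q)" by (intro T_closed) simp
    with Cons show ?case by (simp add: act_mult T_op_def)
  qed
  then have "act (hecke_Tw n q w) x = foldr T_op r x"
    using r by (simp add: hecke_Tw_def r_def reduced_word_def)
  also have "\<dots> = foldr T_op u x"
    by (rule foldr_reduced_word_unique[where A = T_op, OF T_op_commute T_op_braid w r u])
  finally show ?thesis .
qed

end

section \<open>Expansion along subpaths\<close>

lemma subpaths_Nil:
  assumes "S \<in> SYT D"
  shows "subpaths D [] [S] = {([], [S])}"
  using assms by (auto simp: subpaths_def length_Suc_conv)

text \<open>Subpaths depend on the path only through its labels and its first tableau.  A singleton list can
  therefore stand for the tableaux of the path, which makes induction on the labels possible.\<close>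

lemma subpaths_hd: "subpaths D u Ts = subpaths D u [hd Ts]"
  by (simp add: subpaths_def)

definition prepend_step :: "(nat \<Rightarrow> nat) \<Rightarrow> tableau \<Rightarrow> (nat \<Rightarrow> nat) list \<times> tableau list
    \<Rightarrow> (nat \<Rightarrow> nat) list \<times> tableau list" where
  "prepend_step z S \<omega> = (z # fst \<omega>, S # snd \<omega>)"

lemma subpath_Cons_iff:
  assumes "S \<in> SYT D"
  shows "(zs, Ss) \<in> subpaths D (i # u) [S] \<longleftrightarrow>
    (\<exists>z \<in> {simple_refl i, id}. \<exists>\<omega> \<in> subpaths D u [tab_act z S]. (zs, Ss) = prepend_step z S \<omega>)"
proof
  assume sub: "(zs, Ss) \<in> subpaths D (i # u) [S]"
  then obtain z zs' Ss' where eq: "zs = z # zs'" "Ss = S # Ss'"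
    by (auto simp: subpaths_def length_Suc_conv)
  from sub have all: "\<forall>j < Suc (length u). zs ! j \<in> {simple_refl ((i # u) ! j), id} \<and>
      Ss ! Suc j = tab_act (zs ! j) (Ss ! j)"
    by (auto simp: subpaths_def)
  have "Ss' \<noteq> []" using sub eq by (auto simp: subpaths_def)
  then have "hd Ss' = tab_act z S" using all eq by (auto simp: hd_conv_nth)
  then have "(zs', Ss') \<in> subpaths D u [tab_act z S]"
    using sub all[unfolded All_less_Suc2] eq by (auto simp: subpaths_def)
  moreover have "z \<in> {simple_refl i, id}" using all eq by auto
  ultimately show "\<exists>z \<in> {simple_refl i, id}. \<exists>\<omega> \<in> subpaths D u [tab_act z S].
      (zs, Ss) = prepend_step z S \<omega>"
    using eq by (force simp: prepend_step_def)
next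
  assume "\<exists>z \<in> {simple_refl i, id}. \<exists>\<omega> \<in> subpaths D u [tab_act z S].
      (zs, Ss) = prepend_step z S \<omega>"
  then obtain z zs' Ss' where z: "z \<in> {simple_refl i, id}"
    and sub: "(zs', Ss') \<in> subpaths D u [tab_act z S]" and eq: "zs = z # zs'" "Ss = S # Ss'"
    by (auto simp: prepend_step_def)
  have "Ss' \<noteq> []" "hd Ss' = tab_act z S" using sub by (auto simp: subpaths_def)
  then have "Ss' ! 0 = tab_act z S" by (simp add: hd_conv_nth)
  then have "\<forall>j < length (i # u). zs ! j \<in> {simple_refl ((i # u) ! j), id} \<and>
      Ss ! (j + 1) = tab_act (zs ! j) (Ss ! j)"
    using z sub eq by (simp add: All_less_Suc2 subpaths_def)
  then show "(zs, Ss) \<in> subpaths D (i # u) [S]"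
    using sub eq assms by (simp add: subpaths_def)
qed

text \<open>The second set is empty when \<open>s_i S\<close> is nonstandard (\<open>subpaths_empty\<close>), in agreement with the
  vanishing term of the seminormal action.\<close>

lemma subpaths_Cons:
  assumes "S \<in> SYT D"
  shows "subpaths D (i # u) [S] =
    prepend_step id S ` subpaths D u [S] \<union>
    prepend_step (simple_refl i) S ` subpaths D u [tab_act (simple_refl i) S]"
proof -
  have id: "tab_act id S = S" by (simp add: tab_act_def)
  have "(zs, Ss) \<in> subpaths D (i # u) [S] \<longleftrightarrow>
    (\<exists>\<omega> \<in> subpaths D u [S]. (zs, Ss) = prepend_step id S \<omega>) \<or>
    (\<exists>\<omega> \<in> subpaths D u [tab_act (simple_refl i) S]. (zs, Ss) = prepend_step (simple_refl i) S \<omega>)"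
    for zs Ss
    using subpath_Cons_iff[OF assms, of zs Ss i u] id by auto
  then show ?thesis unfolding set_eq_iff image_iff Un_iff split_paired_All by blast
qed

lemma subpaths_empty:
  assumes "S \<notin> SYT D"
  shows "subpaths D u [S] = {}"
proof -
  have False if "(zs, Ss) \<in> subpaths D u [S]" for zs Ss
  proof -
    have "Ss \<noteq> []" "set Ss \<subseteq> SYT D" "hd Ss = S" using that by (auto simp: subpaths_def)
    then show False using assms hd_in_set by blast
  qed
  then show ?thesis by auto
qed

lemma finite_subpaths:
  "finite (subpaths D u [S])"
proof (induction u arbitrary: S)
  case Nil
  then show ?case by (cases "S \<in> SYT D") (simp_all add: subpaths_Nil subpaths_empty)
next
  case (Cons i u)
  then show ?case by (cases "S \<in> SYT D") (simp_all add: subpaths_Cons subpaths_empty)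
qed

lemma inj_prepend_step: "inj_on (prepend_step z S) A"
  by (auto simp: inj_on_def prepend_step_def prod_eq_iff)

lemma q_weight_prepend_step:
  "q_weight q D c (i # u) (prepend_step z S \<omega>) =
     (if z = id then a_coeff q D c i S else a_coeff q D c i S + inverse q) * q_weight q D c u \<omega>"
  unfolding q_weight_def prepend_step_def list.size add_0_right
  by (simp add: prod.lessThan_Suc_shift del: prod.lessThan_Suc cong: if_cong)

lemma last_prepend_step:
  assumes "\<omega> \<in> subpaths D u [S']"
  shows "last (snd (prepend_step z S \<omega>)) = last (snd \<omega>)"
  using assms by (auto simp: prepend_step_def subpaths_def)

context calibrated_module
begin

lemma T_op_basis:
  assumes "S \<in> SYT (boxes lam mu)" "i \<in> {1..<card (boxes lam mu)}"
  shows "T_op i (v S) = scale (a_coeff q (boxes lam mu) c i S) (v S)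
    + scale (a_coeff q (boxes lam mu) c i S + inverse q)
        (if tab_act (simple_refl i) S \<in> SYT (boxes lam mu) then v (tab_act (simple_refl i) S) else 0)"
  unfolding T_op_def act_T[OF assms] by (simp add: add.commute)

lemma fold_T_op_linear:
  assumes "set u \<subseteq> {1..<card (boxes lam mu)}"
  shows "fold T_op u (x + y) = fold T_op u x + fold T_op u y"
    and "fold T_op u (scale a x) = scale a (fold T_op u x)"
    and "fold T_op u 0 = 0"
proof -
  show "fold T_op u (x + y) = fold T_op u x + fold T_op u y" for x y
    using assms by (induction u arbitrary: x y) (simp_all add: T_op_add)
  show scale: "fold T_op u (scale a x) = scale a (fold T_op u x)" for a x
    using assms by (induction u arbitrary: x) (simp_all add: T_op_scale)
  show "fold T_op u 0 = 0" using scale[of 0 0] by simp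
qed

text \<open>The operators are applied in the order of the labels, beginning with the first, so the induction
  removes the first step of the path and changes the starting tableau.\<close>

lemma fold_T_op_subpaths:
  assumes "S \<in> SYT (boxes lam mu)" "set u \<subseteq> {1..<card (boxes lam mu)}"
  shows "fold T_op u (v S) =
    (\<Sum>\<omega> \<in> subpaths (boxes lam mu) u [S]. scale (q_weight q (boxes lam mu) c u \<omega>) (v (last (snd \<omega>))))"
  using assms
proof (induction u arbitrary: S)
  case Nil
  then show ?case by (simp add: subpaths_Nil q_weight_def)
next
  case (Cons i u)
  let ?D = "boxes lam mu"
  let ?a = "a_coeff q ?D c i S" and ?S' = "tab_act (simple_refl i) S"
  let ?sum = "\<lambda>u A. \<Sum>\<omega> \<in> A. scale (q_weight q ?D c u \<omega>) (v (last (snd \<omega>)))"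
  have i: "i \<in> {1..<card ?D}" and u: "set u \<subseteq> {1..<card ?D}" using Cons.prems by auto
  have step: "?sum (i # u) (prepend_step z S ` subpaths ?D u [R]) =
      scale (if z = id then ?a else ?a + inverse q) (?sum u (subpaths ?D u [R]))" for z R
    unfolding sum.reindex[OF inj_prepend_step] scale_sum_right
    by (intro sum.cong refl)
      (simp only: comp_apply q_weight_prepend_step last_prepend_step scale_scale)
  have IH': "?sum u (subpaths ?D u [?S']) = fold T_op u (if ?S' \<in> SYT ?D then v ?S' else 0)"
    using Cons.IH[OF _ u] fold_T_op_linear(3)[OF u] by (simp add: subpaths_empty)
  have "fold T_op (i # u) (v S) = scale ?a (fold T_op u (v S))
      + scale (?a + inverse q) (fold T_op u (if ?S' \<in> SYT ?D then v ?S' else 0))"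
    by (simp only: fold_Cons comp_apply T_op_basis[OF Cons.prems(1) i] fold_T_op_linear[OF u])
  also have "\<dots> = ?sum (i # u) (prepend_step id S ` subpaths ?D u [S])
      + ?sum (i # u) (prepend_step (simple_refl i) S ` subpaths ?D u [?S'])"
    unfolding step IH' Cons.IH[OF Cons.prems(1) u] by simp
  also have "\<dots> = ?sum (i # u) (subpaths ?D (i # u) [S])"
    unfolding subpaths_Cons[OF Cons.prems(1)]
    by (intro sum.union_disjoint[symmetric] finite_imageI finite_subpaths)
      (auto simp: prepend_step_def dest: sym)
  finally show ?case .
qed

lemma natural_vec_subpaths:
  assumes T: "T \<in> SYT (boxes lam mu)"
    and path: "is_path (boxes lam mu) (column_tableau (boxes lam mu)) T u Ts"
    and len: "length u = cox_length (card (boxes lam mu)) (tab_perm (boxes lam mu) T)"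
  shows "natural_vec q (boxes lam mu) act v T =
    (\<Sum>S \<in> {S \<in> SYT (boxes lam mu). tab_le (boxes lam mu) S T}.
       scale (path_coeff q (boxes lam mu) c u Ts S) (v S))"
proof -
  let ?D = "boxes lam mu" and ?C = "column_tableau (boxes lam mu)"
  note D = finite_boxes[of lam mu]
  let ?below = "{S \<in> SYT ?D. tab_le ?D S T}"
  let ?term = "\<lambda>\<omega>. scale (q_weight q ?D c u \<omega>) (v (last (snd \<omega>)))"
  have u: "set u \<subseteq> {1..<card ?D}" and hd: "hd Ts = ?C" using path by (auto simp: is_path_def)
  note sub = subpaths_hd[of ?D u Ts, unfolded hd]
  have below: "(\<lambda>\<omega>. last (snd \<omega>)) ` subpaths ?D u Ts \<subseteq> ?below"
  proof
    fix S assume "S \<in> (\<lambda>\<omega>. last (snd \<omega>)) ` subpaths ?D u Ts"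
    then obtain zs Ss where \<omega>: "(zs, Ss) \<in> subpaths ?D u Ts" and S: "S = last Ss" by auto
    have "Ss \<noteq> []" "set Ss \<subseteq> SYT ?D" using \<omega> by (auto simp: subpaths_def)
    then have "S \<in> SYT ?D" using S last_in_set by blast
    then show "S \<in> ?below" using subpath_bruhat_le[OF D path len \<omega>] S by simp
  qed
  have "natural_vec q ?D act v T = foldr T_op (rev u) (v ?C)"
    unfolding natural_vec_def
    by (rule act_hecke_Tw[OF tab_perm_properties(1)[OF D SYT_young_tableau[OF T]]
          path_reduced_word[OF D path len]])
  also have "\<dots> = fold T_op u (v ?C)" by (simp add: foldr_conv_fold)
  also have "\<dots> = sum ?term (subpaths ?D u Ts)"
    unfolding sub by (rule fold_T_op_subpaths[OF column_tableau_SYT[OF D] u])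
  also have "\<dots> = (\<Sum>S \<in> ?below. sum ?term {\<omega> \<in> subpaths ?D u Ts. last (snd \<omega>) = S})"
    by (rule sum.group[symmetric])
      (use below finite_subpaths[of ?D u ?C] finite_SYT[OF D] sub in simp_all)
  also have "\<dots> = (\<Sum>S \<in> ?below. scale (path_coeff q ?D c u Ts S) (v S))"
    unfolding path_coeff_def scale_sum_left by (intro sum.cong refl) auto
  finally show ?thesis .
qed

end

theorem theorem5p7:
  fixes q :: complex
    and lam mu :: "nat list"
    and c :: "box \<Rightarrow> complex"
    and scale :: "complex \<Rightarrow> 'v :: ab_group_add \<Rightarrow> 'v"
    and act :: "hecke_poly set \<Rightarrow> 'v \<Rightarrow> 'v"
    and v :: "tableau \<Rightarrow> 'v"
    and D :: "box set"
    and T :: tableau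
  assumes "q \<noteq> 0"
    and "\<forall>k::nat. k > 0 \<longrightarrow> q ^ k \<noteq> 1"
    and "placed_skew_shape q lam mu c"
    and "calibrated_module scale q act lam mu c v"
    and "D = boxes lam mu"
    and "T \<in> SYT D"
  shows "(\<exists>is Ts. is_path D (column_tableau D) T is Ts
           \<and> length is = cox_length (card D) (tab_perm D T))
       \<and> (\<forall>is Ts. is_path D (column_tableau D) T is Ts
           \<and> length is = cox_length (card D) (tab_perm D T) \<longrightarrow>
           natural_vec q D act v T
             = (\<Sum>S \<in> {S \<in> SYT D. tab_le D S T}. scale (path_coeff q D c is Ts S) (v S)))"
proof (intro conjI allI impI)
  interpret calibrated_module scale q act lam mu c v by (rule assms(4))
  have D: "finite D" unfolding assms(5) by (rule finite_boxes)
  show "\<exists>is Ts. is_path D (column_tableau D) T is Ts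
      \<and> length is = cox_length (card D) (tab_perm D T)"
    by (rule exists_reduced_path[OF D assms(6)])
  fix u Ts
  assume "is_path D (column_tableau D) T u Ts \<and> length u = cox_length (card D) (tab_perm D T)"
  then show "natural_vec q D act v T
      = (\<Sum>S \<in> {S \<in> SYT D. tab_le D S T}. scale (path_coeff q D c u Ts S) (v S))"
    using natural_vec_subpaths assms(6) unfolding assms(5) by blast
qed

end
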